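(* Over $\mathsf{RCA}_0$, the following are equivalent: (1) For every graph $G$ that is not a random graph, there is a least $n$ such that some $n$-extension pair $\langle X_0,X_1\rangle$ in $G$ fails to have the extension property. (2) $\mathsf{L}\Sigma^0_2$.
   Context: Work in second-order arithmetic. A graph is a pair $G=(V,E)$ with $V\subseteq\mathbb{N}$ nonempty and $E$ irreflexive and symmetric. An $n$-extension pair in $G$ is a pair $\langle X_0,X_1\rangle$ of disjoint finite subsets of $V$ with $|X_0|+|X_1|=n$. It has the extension property if there is a vertex $v\in V\setminus(X_0\cup X_1)$ adjacent to every vertex of $X_0$ and to no vertex of $X_1$. $G$ is a random graph if every $n$-extension pair, for every $n$, has the extension property. $\mathsf{L}\Sigma^0_2$ is the least number principle scheme: for each $\Sigma^0_2$ formula $\varphi(x)$ (with parameters), if some $x$ satisfies $\varphi(x)$ then there is a least such $x$. *)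

theory Defs
  imports Main
begin

text \<open>
  Structures for the language of second-order arithmetic: the numbers are the elements of the
  type \<open>'a\<close>, and the set variables range over the family \<open>sets_of M\<close> of subsets of \<open>'a\<close>
  (Henkin semantics; \<open>sets_of M\<close> need not be the full power set, and the numbers may be
  nonstandard).
\<close>

record 'a l2_structure =
  zero_of :: 'a
  one_of :: 'a
  add_of :: "'a \<Rightarrow> 'a \<Rightarrow> 'a"
  mul_of :: "'a \<Rightarrow> 'a \<Rightarrow> 'a"
  less_of :: "'a \<Rightarrow> 'a \<Rightarrow> bool"
  sets_of :: "'a set set"

text \<open>
  The schemes below only concern formulas without set quantifiers, so the syntax has none.
  Number variables and set variables are two separate families indexed by \<open>nat\<close>; set variables
  occur only as the second argument of \<open>Mem\<close> and serve as set parameters.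
\<close>

datatype num_term =
    NVar nat
  | NZero
  | NOne
  | NAdd num_term num_term
  | NMul num_term num_term

datatype arith_formula =
    Equal num_term num_term
  | Less num_term num_term
  | Mem num_term nat
  | Neg arith_formula
  | Conj arith_formula arith_formula
  | Disj arith_formula arith_formula
  | Impl arith_formula arith_formula
  | Forall nat arith_formula
  | Exists nat arith_formula

primrec term_vars :: "num_term \<Rightarrow> nat set" where
  "term_vars (NVar x) = {x}"
| "term_vars NZero = {}"
| "term_vars NOne = {}"
| "term_vars (NAdd s t) = term_vars s \<union> term_vars t"
| "term_vars (NMul s t) = term_vars s \<union> term_vars t"

primrec term_val :: "'a l2_structure \<Rightarrow> (nat \<Rightarrow> 'a) \<Rightarrow> num_term \<Rightarrow> 'a" where
  "term_val M e (NVar x) = e x"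
| "term_val M e NZero = zero_of M"
| "term_val M e NOne = one_of M"
| "term_val M e (NAdd s t) = add_of M (term_val M e s) (term_val M e t)"
| "term_val M e (NMul s t) = mul_of M (term_val M e s) (term_val M e t)"

primrec sat ::
  "'a l2_structure \<Rightarrow> (nat \<Rightarrow> 'a) \<Rightarrow> (nat \<Rightarrow> 'a set) \<Rightarrow> arith_formula \<Rightarrow> bool" where
  "sat M e S (Equal s t) \<longleftrightarrow> term_val M e s = term_val M e t"
| "sat M e S (Less s t) \<longleftrightarrow> less_of M (term_val M e s) (term_val M e t)"
| "sat M e S (Mem t X) \<longleftrightarrow> term_val M e t \<in> S X"
| "sat M e S (Neg \<phi>) \<longleftrightarrow> \<not> sat M e S \<phi>"
| "sat M e S (Conj \<phi> \<psi>) \<longleftrightarrow> sat M e S \<phi> \<and> sat M e S \<psi>"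
| "sat M e S (Disj \<phi> \<psi>) \<longleftrightarrow> sat M e S \<phi> \<or> sat M e S \<psi>"
| "sat M e S (Impl \<phi> \<psi>) \<longleftrightarrow> (sat M e S \<phi> \<longrightarrow> sat M e S \<psi>)"
| "sat M e S (Forall x \<phi>) \<longleftrightarrow> (\<forall>a. sat M (e(x := a)) S \<phi>)"
| "sat M e S (Exists x \<phi>) \<longleftrightarrow> (\<exists>a. sat M (e(x := a)) S \<phi>)"

text \<open>
  Formulas with bounded quantifiers only. The bounded quantifiers \<open>\<forall>x<t. \<phi>\<close> and \<open>\<exists>x<t. \<phi>\<close>
  abbreviate \<open>\<forall>x. x < t \<longrightarrow> \<phi>\<close> and \<open>\<exists>x. x < t \<and> \<phi>\<close> for a term \<open>t\<close> not mentioning \<open>x\<close>.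
\<close>

inductive delta0 :: "arith_formula \<Rightarrow> bool" where
  "delta0 (Equal s t)"
| "delta0 (Less s t)"
| "delta0 (Mem t X)"
| "delta0 \<phi> \<Longrightarrow> delta0 (Neg \<phi>)"
| "delta0 \<phi> \<Longrightarrow> delta0 \<psi> \<Longrightarrow> delta0 (Conj \<phi> \<psi>)"
| "delta0 \<phi> \<Longrightarrow> delta0 \<psi> \<Longrightarrow> delta0 (Disj \<phi> \<psi>)"
| "delta0 \<phi> \<Longrightarrow> delta0 \<psi> \<Longrightarrow> delta0 (Impl \<phi> \<psi>)"
| "delta0 \<phi> \<Longrightarrow> x \<notin> term_vars t \<Longrightarrow> delta0 (Forall x (Impl (Less (NVar x) t) \<phi>))"
| "delta0 \<phi> \<Longrightarrow> x \<notin> term_vars t \<Longrightarrow> delta0 (Exists x (Conj (Less (NVar x) t) \<phi>))"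

definition sigma1 :: "arith_formula \<Rightarrow> bool" where
  "sigma1 \<phi> \<longleftrightarrow> (\<exists>x \<theta>. \<phi> = Exists x \<theta> \<and> delta0 \<theta>)"

definition pi1 :: "arith_formula \<Rightarrow> bool" where
  "pi1 \<phi> \<longleftrightarrow> (\<exists>x \<theta>. \<phi> = Forall x \<theta> \<and> delta0 \<theta>)"

definition sigma2 :: "arith_formula \<Rightarrow> bool" where
  "sigma2 \<phi> \<longleftrightarrow> (\<exists>x \<psi>. \<phi> = Exists x \<psi> \<and> pi1 \<psi>)"

definition basic_axioms :: "'a l2_structure \<Rightarrow> bool" where
  "basic_axioms M \<longleftrightarrow>
     (\<forall>m. add_of M m (one_of M) \<noteq> zero_of M) \<and>
     (\<forall>m n. add_of M m (one_of M) = add_of M n (one_of M) \<longrightarrow> m = n) \<and>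
     (\<forall>m. add_of M m (zero_of M) = m) \<and>
     (\<forall>m n. add_of M m (add_of M n (one_of M)) = add_of M (add_of M m n) (one_of M)) \<and>
     (\<forall>m. mul_of M m (zero_of M) = zero_of M) \<and>
     (\<forall>m n. mul_of M m (add_of M n (one_of M)) = add_of M (mul_of M m n) m) \<and>
     (\<forall>m. \<not> less_of M m (zero_of M)) \<and>
     (\<forall>m n. less_of M m (add_of M n (one_of M)) \<longleftrightarrow> less_of M m n \<or> m = n)"

text \<open>
  A structure satisfies a scheme if it satisfies the universal closure of every instance.
  Assignments supply the number and set parameters; set parameters are taken from the structure.
\<close>

definition set_assignment :: "'a l2_structure \<Rightarrow> (nat \<Rightarrow> 'a set) \<Rightarrow> bool" where
  "set_assignment M S \<longleftrightarrow> (\<forall>X. S X \<in> sets_of M)"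

definition sigma1_induction :: "'a l2_structure \<Rightarrow> bool" where
  "sigma1_induction M \<longleftrightarrow>
     (\<forall>\<phi> x e S. sigma1 \<phi> \<longrightarrow> set_assignment M S \<longrightarrow>
        sat M (e(x := zero_of M)) S \<phi> \<longrightarrow>
        (\<forall>a. sat M (e(x := a)) S \<phi> \<longrightarrow> sat M (e(x := add_of M a (one_of M))) S \<phi>) \<longrightarrow>
        (\<forall>a. sat M (e(x := a)) S \<phi>))"

definition delta1_comprehension :: "'a l2_structure \<Rightarrow> bool" where
  "delta1_comprehension M \<longleftrightarrow>
     (\<forall>\<phi> \<psi> x e S. sigma1 \<phi> \<longrightarrow> pi1 \<psi> \<longrightarrow> set_assignment M S \<longrightarrow>
        (\<forall>a. sat M (e(x := a)) S \<phi> \<longleftrightarrow> sat M (e(x := a)) S \<psi>) \<longrightarrow>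
        (\<exists>A\<in>sets_of M. \<forall>a. a \<in> A \<longleftrightarrow> sat M (e(x := a)) S \<phi>))"

text \<open>
  The first conjunct is the usual convention that both sorts of a structure are nonempty;
  without it there would be no set assignments and the schemes would hold vacuously.
\<close>

definition models_RCA0 :: "'a l2_structure \<Rightarrow> bool" where
  "models_RCA0 M \<longleftrightarrow>
     sets_of M \<noteq> {} \<and> basic_axioms M \<and> sigma1_induction M \<and> delta1_comprehension M"

definition models_L_Sigma2 :: "'a l2_structure \<Rightarrow> bool" where
  "models_L_Sigma2 M \<longleftrightarrow>
     (\<forall>\<phi> x e S. sigma2 \<phi> \<longrightarrow> set_assignment M S \<longrightarrow>
        (\<exists>a. sat M (e(x := a)) S \<phi>) \<longrightarrow>
        (\<exists>a. sat M (e(x := a)) S \<phi> \<and>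
             (\<forall>b. less_of M b a \<longrightarrow> \<not> sat M (e(x := b)) S \<phi>)))"

text \<open>
  The graph-theoretic notions, read inside \<open>M\<close>: all number quantifiers range over the numbers
  of \<open>M\<close> and all set quantifiers over \<open>sets_of M\<close>. Ordered pairs of numbers are coded by the
  standard pairing \<open>(i, j) = (i + j)\<^sup>2 + i\<close> of second-order arithmetic, and relations and functions
  are sets of such codes.
\<close>

definition pair_in :: "'a l2_structure \<Rightarrow> 'a \<Rightarrow> 'a \<Rightarrow> 'a" where
  "pair_in M i j = add_of M (mul_of M (add_of M i j) (add_of M i j)) i"

definition graph_in :: "'a l2_structure \<Rightarrow> 'a set \<Rightarrow> 'a set \<Rightarrow> bool" where
  "graph_in M V E \<longleftrightarrow>
     V \<in> sets_of M \<and> E \<in> sets_of M \<and> V \<noteq> {} \<and>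
     (\<forall>z\<in>E. \<exists>u\<in>V. \<exists>v\<in>V. z = pair_in M u v) \<and>
     (\<forall>u\<in>V. pair_in M u u \<notin> E) \<and>
     (\<forall>u\<in>V. \<forall>v\<in>V. pair_in M u v \<in> E \<longrightarrow> pair_in M v u \<in> E)"

definition finite_in :: "'a l2_structure \<Rightarrow> 'a set \<Rightarrow> bool" where
  "finite_in M X \<longleftrightarrow> X \<in> sets_of M \<and> (\<exists>b. \<forall>x\<in>X. less_of M x b)"

text \<open>\<open>|X| = n\<close>: some set of \<open>M\<close> codes a bijection between \<open>{i. i < n}\<close> and \<open>X\<close>.\<close>

definition card_in :: "'a l2_structure \<Rightarrow> 'a set \<Rightarrow> 'a \<Rightarrow> bool" where
  "card_in M X n \<longleftrightarrow>
     (\<exists>f\<in>sets_of M.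
        (\<forall>z\<in>f. \<exists>i x. z = pair_in M i x \<and> less_of M i n \<and> x \<in> X) \<and>
        (\<forall>i. less_of M i n \<longrightarrow> (\<exists>!x. pair_in M i x \<in> f)) \<and>
        (\<forall>x\<in>X. \<exists>!i. pair_in M i x \<in> f))"

definition extension_pair_in ::
  "'a l2_structure \<Rightarrow> 'a set \<Rightarrow> 'a \<Rightarrow> 'a set \<Rightarrow> 'a set \<Rightarrow> bool" where
  "extension_pair_in M V n X0 X1 \<longleftrightarrow>
     finite_in M X0 \<and> finite_in M X1 \<and> X0 \<subseteq> V \<and> X1 \<subseteq> V \<and> X0 \<inter> X1 = {} \<and>
     (\<exists>k l. card_in M X0 k \<and> card_in M X1 l \<and> add_of M k l = n)"

definition extension_property_in ::
  "'a l2_structure \<Rightarrow> 'a set \<Rightarrow> 'a set \<Rightarrow> 'a set \<Rightarrow> 'a set \<Rightarrow> bool" where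
  "extension_property_in M V E X0 X1 \<longleftrightarrow>
     (\<exists>v\<in>V - (X0 \<union> X1). (\<forall>x\<in>X0. pair_in M v x \<in> E) \<and> (\<forall>x\<in>X1. pair_in M v x \<notin> E))"

definition random_graph_in :: "'a l2_structure \<Rightarrow> 'a set \<Rightarrow> 'a set \<Rightarrow> bool" where
  "random_graph_in M V E \<longleftrightarrow>
     graph_in M V E \<and>
     (\<forall>n. \<forall>X0\<in>sets_of M. \<forall>X1\<in>sets_of M.
        extension_pair_in M V n X0 X1 \<longrightarrow> extension_property_in M V E X0 X1)"

definition some_extension_fails_in ::
  "'a l2_structure \<Rightarrow> 'a set \<Rightarrow> 'a set \<Rightarrow> 'a \<Rightarrow> bool" where
  "some_extension_fails_in M V E n \<longleftrightarrow>
     (\<exists>X0\<in>sets_of M. \<exists>X1\<in>sets_of M.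
        extension_pair_in M V n X0 X1 \<and> \<not> extension_property_in M V E X0 X1)"

definition models_least_failing_extension :: "'a l2_structure \<Rightarrow> bool" where
  "models_least_failing_extension M \<longleftrightarrow>
     (\<forall>V\<in>sets_of M. \<forall>E\<in>sets_of M. graph_in M V E \<longrightarrow> \<not> random_graph_in M V E \<longrightarrow>
        (\<exists>n. some_extension_fails_in M V E n \<and>
             (\<forall>m. less_of M m n \<longrightarrow> \<not> some_extension_fails_in M V E m)))"

end

theory Submission
  imports Defs
begin

text \<open>
  A subset of a model \<open>M\<close> that is bounded and belongs to \<open>M\<close> is coded by a number: divisibility by
  the pairwise coprime numbers \<open>1 + (x + 1) d\<close> encodes membership of \<open>x\<close>. Hence "some
  \<open>n\<close>-extension pair fails" is a \<open>\<Sigma>\<^sup>0\<^sub>2\<close> property of \<open>n\<close>, and the least number principle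
  yields a least such \<open>n\<close>.

  Conversely, let \<open>\<exists>y. \<forall>z. R m y z\<close> be a \<open>\<Sigma>\<^sup>0\<^sub>2\<close> property of \<open>m\<close>. Take all numbers as vertices. A vertex
  \<open>v\<close> is read as a coded enumeration \<open>f\<close> of a finite set \<open>X\<close> in \<open>n\<close> steps together with a stage
  \<open>s\<close>, and it is joined to the elements of \<open>X\<close> if for all \<open>m < n\<close> and \<open>y < f\<close> the failure of
  \<open>\<forall>z. R m y z\<close> is witnessed below \<open>s\<close>. If the property fails for all \<open>m < n\<close>, then \<open>\<Sigma>\<^sup>0\<^sub>1\<close>
  bounding supplies a stage at which a given \<open>n\<close>-extension pair gets its vertex. If it holds at
  \<open>m\<close> with witness \<open>y\<close>, then \<open>m + 1\<close> vertices that have no smaller neighbours and exceed \<open>y\<close> have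
  no common neighbour, since by the pigeonhole principle such a neighbour would have \<open>n > m\<close> and
  \<open>y < f\<close>. So \<open>m\<close> has the property for some \<open>m < n\<close> iff some \<open>n'\<close>-extension pair with
  \<open>n' \<le> n\<close> fails.
\<close>

section \<open>Fresh variables of a formula\<close>

text \<open>Freshness is expressed semantically: a formula contains finitely many variables, so
  changing the assignment at any large enough index has no effect. It supplies auxiliary variables
  for the arbitrary formulas handled in \<open>rec_matrix\<close>.\<close>

lemma ex_fresh_variable:
  "\<exists>N. \<forall>w\<ge>N. \<forall>e a. sat M (e(w := a)) S \<phi> = sat M e S \<phi>"
proof -
  have vals: "\<exists>N. \<forall>w\<ge>N. \<forall>e a. term_val M (e(w := a)) t = term_val M e t" for t
  proof (induction t)
    case (NVar x)
    show ?case by (rule exI[of _ "Suc x"]) auto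
  next
    case (NAdd s t)
    then obtain N1 N2 where "\<forall>w\<ge>N1. \<forall>e a. term_val M (e(w := a)) s = term_val M e s"
      "\<forall>w\<ge>N2. \<forall>e a. term_val M (e(w := a)) t = term_val M e t" by blast
    then show ?case by (intro exI[of _ "max N1 N2"]) (simp del: fun_upd_apply)
  next
    case (NMul s t)
    then obtain N1 N2 where "\<forall>w\<ge>N1. \<forall>e a. term_val M (e(w := a)) s = term_val M e s"
      "\<forall>w\<ge>N2. \<forall>e a. term_val M (e(w := a)) t = term_val M e t" by blast
    then show ?case by (intro exI[of _ "max N1 N2"]) (simp del: fun_upd_apply)
  qed auto
  have quantifier: "\<exists>N. \<forall>w\<ge>N. \<forall>e a b. sat M (e(w := a, x := b)) S \<phi> = sat M (e(x := b)) S \<phi>"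
    if "\<exists>N. \<forall>w\<ge>N. \<forall>e a. sat M (e(w := a)) S \<phi> = sat M e S \<phi>" for x \<phi>
  proof -
    from that obtain N where N: "\<And>w e a. w \<ge> N \<Longrightarrow> sat M (e(w := a)) S \<phi> = sat M e S \<phi>" by blast
    show ?thesis
    proof (intro exI[of _ "max N (Suc x)"] allI impI)
      \<comment> \<open>The bound \<open>Suc x\<close> forces \<open>w\<close> to differ from
        \<open>x\<close>, so the two updates commute.\<close>
      fix w e a b assume "w \<ge> max N (Suc x)"
      then show "sat M (e(w := a, x := b)) S \<phi> = sat M (e(x := b)) S \<phi>"
        using N[of w "e(x := b)" a] by (simp add: fun_upd_twist[of w x])
    qed
  qed
  have binary: "\<exists>N. (\<forall>w\<ge>N. P w) \<and> (\<forall>w\<ge>N. Q w)" if "\<exists>N. \<forall>w\<ge>N. P w" "\<exists>N. \<forall>w\<ge>N. Q w" for P Q :: "nat \<Rightarrow> bool"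
  proof -
    from that obtain N1 N2 where "\<forall>w\<ge>N1. P w" "\<forall>w\<ge>N2. Q w" by blast
    then show ?thesis by (intro exI[of _ "max N1 N2"]) simp
  qed
  show ?thesis
  proof (induction \<phi>)
    case (Equal s t)
    from binary[OF vals[of s] vals[of t]] show ?case by (elim exE, rule_tac x = N in exI) (simp del: fun_upd_apply)
  next
    case (Less s t)
    from binary[OF vals[of s] vals[of t]] show ?case by (elim exE, rule_tac x = N in exI) (simp del: fun_upd_apply)
  next
    case (Mem t X)
    from vals[of t] show ?case by (elim exE, rule_tac x = N in exI) (simp del: fun_upd_apply)
  next
    case (Neg \<phi>)
    then show ?case by simp
  next
    case (Conj \<phi> \<psi>)
    from binary[OF this] show ?case by (elim exE, rule_tac x = N in exI) (simp del: fun_upd_apply)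
  next
    case (Disj \<phi> \<psi>)
    from binary[OF this] show ?case by (elim exE, rule_tac x = N in exI) (simp del: fun_upd_apply)
  next
    case (Impl \<phi> \<psi>)
    from binary[OF this] show ?case by (elim exE, rule_tac x = N in exI) (simp del: fun_upd_apply)
  next
    case (Forall x \<phi>)
    from quantifier[OF this, of x] show ?case by (elim exE, rule_tac x = N in exI) (simp del: fun_upd_apply)
  next
    case (Exists x \<phi>)
    from quantifier[OF this, of x] show ?case by (elim exE, rule_tac x = N in exI) (simp del: fun_upd_apply)
  qed
qed

section \<open>Arithmetic in a model\<close>

locale rca =
  fixes M :: "'a l2_structure"
  assumes RCA0: "models_RCA0 M"
begin

abbreviation zero ("\<zero>") where "\<zero> \<equiv> zero_of M"
abbreviation one ("\<one>") where "\<one> \<equiv> one_of M"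
abbreviation add (infixl "\<oplus>" 65) where "a \<oplus> b \<equiv> add_of M a b"
abbreviation mul (infixl "\<otimes>" 70) where "a \<otimes> b \<equiv> mul_of M a b"
abbreviation lt (infix "\<prec>" 50) where "a \<prec> b \<equiv> less_of M a b"

lemma basic: "basic_axioms M" and sets_nonempty: "sets_of M \<noteq> {}"
  and sigma1_induction: "sigma1_induction M" and delta1_comprehension: "delta1_comprehension M"
  using RCA0 by (simp_all add: models_RCA0_def)

lemma succ_neq_zero [simp]: "a \<oplus> \<one> \<noteq> \<zero>"
  and succ_inject [simp]: "a \<oplus> \<one> = b \<oplus> \<one> \<longleftrightarrow> a = b"
  and add_zero: "a \<oplus> \<zero> = a"
  and add_succ: "a \<oplus> (b \<oplus> \<one>) = (a \<oplus> b) \<oplus> \<one>"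
  and mul_zero: "a \<otimes> \<zero> = \<zero>"
  and mul_succ: "a \<otimes> (b \<oplus> \<one>) = a \<otimes> b \<oplus> a"
  and not_less_zero: "\<not> a \<prec> \<zero>"
  and less_succ: "a \<prec> b \<oplus> \<one> \<longleftrightarrow> a \<prec> b \<or> a = b"
  using basic unfolding basic_axioms_def by metis+

text \<open>Variables 1 and 2 carry parameters, which leaves variable 0 for the induction or
  comprehension variable.\<close>

definition params :: "'a \<Rightarrow> 'a \<Rightarrow> nat \<Rightarrow> 'a" where
  "params b c = (\<lambda>_. \<zero>)(1 := b, 2 := c)"

lemma params_simps [simp]:
  "params b c (Suc 0) = b" "params b c 2 = c"
  by (simp_all add: params_def)

lemma ex_set_assignment: "\<exists>S. set_assignment M S"
  using sets_nonempty by (auto simp: set_assignment_def)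

text \<open>Variable 9 serves as the vacuous unbounded quantifier that turns \<open>\<theta>\<close> into a
  \<open>\<Sigma>\<^sup>0\<^sub>1\<close> and a \<open>\<Pi>\<^sup>0\<^sub>1\<close> formula.\<close>

lemma delta0_comprehension:
  assumes "delta0 \<theta>" "\<And>e b. sat M (e(9 := b)) S \<theta> = sat M e S \<theta>" "set_assignment M S"
  shows "{a. sat M (e(0 := a)) S \<theta>} \<in> sets_of M"
proof -
  have "sigma1 (Exists 9 \<theta>)" "pi1 (Forall 9 \<theta>)"
    using assms(1) by (auto simp: sigma1_def pi1_def)
  moreover have "\<forall>a. sat M (e(0 := a)) S (Exists 9 \<theta>) \<longleftrightarrow> sat M (e(0 := a)) S (Forall 9 \<theta>)"
    using assms(2) by simp
  ultimately have "\<exists>A\<in>sets_of M. \<forall>a. a \<in> A \<longleftrightarrow> sat M (e(0 := a)) S (Exists 9 \<theta>)"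
    using delta1_comprehension[unfolded delta1_comprehension_def, rule_format, of "Exists 9 \<theta>" "Forall 9 \<theta>" S e 0]
      assms(3) by simp
  then obtain A where "A \<in> sets_of M" "\<forall>a. a \<in> A \<longleftrightarrow> sat M (e(0 := a)) S (Exists 9 \<theta>)"
    by blast
  moreover from this have "A = {a. sat M (e(0 := a)) S \<theta>}"
    using assms(2) by auto
  ultimately show ?thesis by simp
qed

lemma set_induct:
  assumes "A \<in> sets_of M" "\<zero> \<in> A" "\<And>a. a \<in> A \<Longrightarrow> a \<oplus> \<one> \<in> A"
  shows "a \<in> A"
proof -
  \<comment> \<open>\<open>sigma1\<close> asks for a leading existential quantifier; variable 1 is a
    dummy that supplies it.\<close>
  define \<phi> where "\<phi> = Exists 1 (Mem (NVar 0) 0)"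
  have "sigma1 \<phi>" by (auto simp: sigma1_def \<phi>_def intro: delta0.intros)
  moreover have "set_assignment M (\<lambda>_. A)" using assms(1) by (simp add: set_assignment_def)
  moreover have sat: "sat M (e(0 := a)) (\<lambda>_. A) \<phi> \<longleftrightarrow> a \<in> A" for e a by (simp add: \<phi>_def)
  ultimately have "\<forall>a. sat M ((\<lambda>_. \<zero>)(0 := a)) (\<lambda>_. A) \<phi>"
    using sigma1_induction[unfolded sigma1_induction_def, rule_format, of \<phi> "\<lambda>_. A" "\<lambda>_. \<zero>" 0] assms(2,3)
    by (simp only: sat) simp
  then show ?thesis by (simp only: sat)
qed

text \<open>Comprehension turns the property into a set of \<open>M\<close>, to which
  \<open>set_induct\<close> applies. The arithmetic laws below follow by naming the formula that
  expresses them.\<close>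

lemma delta0_induct:
  assumes "delta0 \<theta>" "\<And>e b S. sat M (e(9 := b)) S \<theta> = sat M e S \<theta>"
    and P: "\<And>a S. sat M (e(0 := a)) S \<theta> = P a"
    and "P \<zero>" "\<And>a. P a \<Longrightarrow> P (a \<oplus> \<one>)"
  shows "P a"
proof -
  obtain S where S: "set_assignment M S" using ex_set_assignment by blast
  have "a \<in> {a. P a}"
    by (rule set_induct) (use delta0_comprehension[OF assms(1,2) S, of e] assms(4,5) in \<open>simp_all add: P\<close>)
  then show ?thesis by auto
qed

declare delta0.intros [simp]

section \<open>Semiring and order laws\<close>

lemma zero_add: "\<zero> \<oplus> a = a"
  by (rule delta0_induct[of "Equal (NAdd NZero (NVar 0)) (NVar 0)" "params \<zero> \<zero>" _ a])
    (simp_all add: add_zero add_succ)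

lemma succ_add: "(b \<oplus> \<one>) \<oplus> a = (b \<oplus> a) \<oplus> \<one>"
  by (rule delta0_induct[of "Equal (NAdd (NAdd (NVar 1) NOne) (NVar 0))
    (NAdd (NAdd (NVar 1) (NVar 0)) NOne)" "params b \<zero>" _ a])
    (simp_all add: add_zero add_succ)

lemma add_commute': "a \<oplus> b = b \<oplus> a"
  by (rule delta0_induct[of "Equal (NAdd (NVar 0) (NVar 1)) (NAdd (NVar 1) (NVar 0))" "params b \<zero>" _ a])
    (simp_all add: add_zero zero_add add_succ succ_add)

lemma add_assoc': "(b \<oplus> c) \<oplus> a = b \<oplus> (c \<oplus> a)"
  by (rule delta0_induct[of "Equal (NAdd (NAdd (NVar 1) (NVar 2)) (NVar 0))
    (NAdd (NVar 1) (NAdd (NVar 2) (NVar 0)))" "params b c" _ a])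
    (simp_all add: add_zero add_succ)

lemma add_left_commute': "b \<oplus> (c \<oplus> a) = c \<oplus> (b \<oplus> a)"
  by (metis add_assoc' add_commute')

lemma zero_mul: "\<zero> \<otimes> a = \<zero>"
  by (rule delta0_induct[of "Equal (NMul NZero (NVar 0)) NZero" "params \<zero> \<zero>" _ a])
    (simp_all add: mul_zero mul_succ add_zero)

lemma succ_mul: "(b \<oplus> \<one>) \<otimes> a = b \<otimes> a \<oplus> a"
  by (rule delta0_induct[of "Equal (NMul (NAdd (NVar 1) NOne) (NVar 0))
    (NAdd (NMul (NVar 1) (NVar 0)) (NVar 0))" "params b \<zero>" _ a])
    (simp_all add: mul_zero mul_succ add_zero add_assoc' add_left_commute' add_commute')

lemma mul_commute': "a \<otimes> b = b \<otimes> a"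
  by (rule delta0_induct[of "Equal (NMul (NVar 0) (NVar 1)) (NMul (NVar 1) (NVar 0))" "params b \<zero>" _ a])
    (simp_all add: mul_zero zero_mul mul_succ succ_mul)

lemma add_mul: "(b \<oplus> c) \<otimes> a = b \<otimes> a \<oplus> c \<otimes> a"
  by (rule delta0_induct[of "Equal (NMul (NAdd (NVar 1) (NVar 2)) (NVar 0))
    (NAdd (NMul (NVar 1) (NVar 0)) (NMul (NVar 2) (NVar 0)))" "params b c" _ a])
    (simp_all add: mul_zero mul_succ add_zero add_assoc' add_left_commute' add_commute')

lemma mul_assoc': "(b \<otimes> c) \<otimes> a = b \<otimes> (c \<otimes> a)"
  by (rule delta0_induct[of "Equal (NMul (NMul (NVar 1) (NVar 2)) (NVar 0))
    (NMul (NVar 1) (NMul (NVar 2) (NVar 0)))" "params b c" _ a])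
    (simp_all add: mul_zero mul_succ, metis add_mul mul_commute')

lemma one_mul: "\<one> \<otimes> a = a"
  by (rule delta0_induct[of "Equal (NMul NOne (NVar 0)) (NVar 0)" "params \<zero> \<zero>" _ a])
    (simp_all add: mul_zero mul_succ)

lemma add_right_cancel': "b \<oplus> a = c \<oplus> a \<longleftrightarrow> b = c"
  by (rule delta0_induct[of "Impl (Equal (NAdd (NVar 1) (NVar 0)) (NAdd (NVar 2) (NVar 0)))
    (Equal (NVar 1) (NVar 2))" "params b c" _ a])
    (auto simp add: add_zero add_succ)

lemma less_trans' [rule_format]: "c \<prec> a \<longrightarrow> b \<prec> c \<longrightarrow> b \<prec> a"
  by (rule delta0_induct[of "Impl (Less (NVar 2) (NVar 0)) (Impl (Less (NVar 1) (NVar 2))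
    (Less (NVar 1) (NVar 0)))" "params b c" _ a])
    (auto simp add: not_less_zero less_succ)

lemma less_irrefl': "\<not> a \<prec> a"
  by (rule delta0_induct[of "Neg (Less (NVar 0) (NVar 0))" "params \<zero> \<zero>" _ a])
    (simp_all add: not_less_zero less_succ, metis less_succ less_trans')

lemma zero_less_or_eq: "\<zero> \<prec> a \<or> \<zero> = a"
  by (rule delta0_induct[of "Disj (Less NZero (NVar 0)) (Equal NZero (NVar 0))" "params \<zero> \<zero>" _ a])
    (auto simp add: less_succ)

lemma succ_le [rule_format]: "b \<prec> a \<longrightarrow> b \<oplus> \<one> \<prec> a \<or> b \<oplus> \<one> = a"
  by (rule delta0_induct[of "Impl (Less (NVar 1) (NVar 0))
    (Disj (Less (NAdd (NVar 1) NOne) (NVar 0)) (Equal (NAdd (NVar 1) NOne) (NVar 0)))" "params b \<zero>" _ a])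
    (auto simp add: less_succ not_less_zero)

lemma less_linear': "a \<prec> b \<or> a = b \<or> b \<prec> a"
  by (rule delta0_induct[of "Disj (Less (NVar 0) (NVar 1)) (Disj (Equal (NVar 0) (NVar 1))
    (Less (NVar 1) (NVar 0)))" "params b \<zero>" _ a])
    (use zero_less_or_eq[of b] succ_le[of _ b] in \<open>auto simp: less_succ\<close>)

lemma add_less_cancel': "b \<oplus> a \<prec> c \<oplus> a \<longleftrightarrow> b \<prec> c"
proof -
  have succ: "b \<oplus> \<one> \<prec> c \<oplus> \<one> \<longleftrightarrow> b \<prec> c" for b c
    by (metis less_irrefl' less_succ less_trans' succ_le)
  show ?thesis
    by (rule delta0_induct[of "Conj (Impl (Less (NAdd (NVar 1) (NVar 0)) (NAdd (NVar 2) (NVar 0)))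
        (Less (NVar 1) (NVar 2))) (Impl (Less (NVar 1) (NVar 2))
        (Less (NAdd (NVar 1) (NVar 0)) (NAdd (NVar 2) (NVar 0))))" "params b c" _ a])
      (auto simp add: add_zero add_succ succ)
qed

text \<open>The conjunct \<open>c \<prec> a\<close> bounds the quantifier, so the statement is a
  formula to which \<open>delta0_induct\<close> applies.\<close>

lemma less_imp_ex: "b \<prec> a \<Longrightarrow> \<exists>c. c \<prec> a \<and> b \<oplus> (c \<oplus> \<one>) = a"
proof -
  let ?P = "\<lambda>a. b \<prec> a \<longrightarrow> (\<exists>c. c \<prec> a \<and> b \<oplus> (c \<oplus> \<one>) = a)"
  have "?P (a \<oplus> \<one>)" if "?P a" for a
  proof
    assume "b \<prec> a \<oplus> \<one>"
    then consider "b \<prec> a" | "b = a" using less_succ by blast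
    then show "\<exists>c. c \<prec> a \<oplus> \<one> \<and> b \<oplus> (c \<oplus> \<one>) = a \<oplus> \<one>"
    proof cases
      case 1
      then obtain c where c: "c \<prec> a" "b \<oplus> (c \<oplus> \<one>) = a" using \<open>?P a\<close> by blast
      have "c \<oplus> \<one> \<prec> a \<oplus> \<one>" using succ_le[OF c(1)] less_succ by blast
      moreover have "b \<oplus> ((c \<oplus> \<one>) \<oplus> \<one>) = a \<oplus> \<one>" by (simp only: add_succ[of b "c \<oplus> \<one>"] c(2))
      ultimately show ?thesis by blast
    next
      case 2
      have "\<zero> \<prec> a \<oplus> \<one>" using zero_less_or_eq less_succ by blast
      then show ?thesis using 2 zero_add by metis
    qed
  qed
  then have "?P a"
    by (intro delta0_induct[of "Impl (Less (NVar 1) (NVar 0)) (Exists 2 (Conj (Less (NVar 2) (NVar 0))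
      (Equal (NAdd (NVar 1) (NAdd (NVar 2) NOne)) (NVar 0))))" "params b \<zero>" ?P a])
      (simp_all add: not_less_zero)
  then show "b \<prec> a \<Longrightarrow> \<exists>c. c \<prec> a \<and> b \<oplus> (c \<oplus> \<one>) = a" by blast
qed

section \<open>Order and truncated subtraction\<close>

definition le (infix "\<preceq>" 50) where "a \<preceq> b \<longleftrightarrow> a \<prec> b \<or> a = b"
text \<open>\<open>linordered_semidom\<close> comes with a subtraction. The default value \<zero>
  makes \<open>minus_minus\<close> and \<open>mul_minus\<close> hold in all cases.\<close>

definition minus (infixl "\<ominus>" 65) where "a \<ominus> b = (if b \<preceq> a then THE c. b \<oplus> c = a else \<zero>)"

lemma le_imp_ex: "b \<preceq> a \<Longrightarrow> \<exists>c. b \<oplus> c = a"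
  unfolding le_def using less_imp_ex add_zero by blast

lemma le_add: "b \<preceq> b \<oplus> c"
  by (metis add_commute' add_less_cancel' le_def zero_add zero_less_or_eq)

lemma add_minus: "(b \<oplus> c) \<ominus> b = c"
proof -
  have "b \<oplus> d = b \<oplus> c \<longleftrightarrow> d = c" for d
    by (metis add_commute' add_right_cancel')
  then show ?thesis by (simp add: minus_def le_add)
qed

lemma le_iff_add: "b \<preceq> a \<longleftrightarrow> (\<exists>c. a = b \<oplus> c)"
  using le_imp_ex le_add by metis

lemma minus_eq_zero: "\<not> b \<preceq> a \<Longrightarrow> a \<ominus> b = \<zero>"
  by (simp add: minus_def)

lemma zero_minus: "\<zero> \<ominus> a = \<zero>"
proof (cases "a = \<zero>")
  case True
  then show ?thesis using add_minus[of \<zero> \<zero>] by (simp add: add_zero)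
next
  case False
  then show ?thesis by (intro minus_eq_zero) (simp add: le_def not_less_zero)
qed

lemma minus_minus: "a \<ominus> b \<ominus> c = a \<ominus> (b \<oplus> c)"
proof (cases "b \<preceq> a")
  case True
  then obtain d where d: "a = b \<oplus> d" using le_iff_add by blast
  have "c \<preceq> d \<longleftrightarrow> b \<oplus> c \<preceq> b \<oplus> d"
    by (metis add_commute' add_right_cancel' add_less_cancel' le_def)
  then show ?thesis using d add_minus le_iff_add minus_eq_zero by (metis add_assoc')
next
  case False
  then have "\<not> b \<oplus> c \<preceq> a" using le_iff_add add_assoc' by metis
  with False show ?thesis by (simp add: minus_eq_zero zero_minus)
qed

lemma mul_less: "a \<prec> b \<Longrightarrow> \<zero> \<prec> c \<Longrightarrow> c \<otimes> a \<prec> c \<otimes> b"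
proof -
  assume "a \<prec> b" "\<zero> \<prec> c"
  then obtain d where d: "b = a \<oplus> (d \<oplus> \<one>)" using less_imp_ex by metis
  have "c \<otimes> b = c \<otimes> a \<oplus> (c \<otimes> d \<oplus> c)"
    by (metis d add_mul mul_commute' mul_succ)
  moreover have "\<zero> \<prec> c \<otimes> d \<oplus> c"
    using \<open>\<zero> \<prec> c\<close> by (metis add_commute' le_add le_def less_trans')
  ultimately show ?thesis by (metis add_commute' add_less_cancel' zero_add)
qed

lemma mul_minus: "a \<otimes> (b \<ominus> c) = a \<otimes> b \<ominus> a \<otimes> c"
proof (cases "c \<preceq> b")
  case True
  then obtain d where "b = c \<oplus> d" using le_iff_add by blast
  then show ?thesis by (metis add_minus add_mul mul_commute')
next
  case False
  then have "b \<prec> c" using less_linear' le_def by blast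
  then have "a = \<zero> \<or> a \<otimes> b \<prec> a \<otimes> c"
    using mul_less zero_less_or_eq by metis
  then have "a \<otimes> b \<ominus> a \<otimes> c = \<zero>"
    by (metis le_def less_irrefl' less_trans' minus_eq_zero zero_mul zero_minus)
  then show ?thesis using False by (simp add: minus_eq_zero mul_zero)
qed

lemma zero_less_one: "\<zero> \<prec> \<one>"
  by (metis less_succ zero_add)

text \<open>From here on the library's algebra, order and divisibility facts apply to the numbers of
  \<open>M\<close>, with the prefix \<open>M\<close>.\<close>

sublocale M: linordered_semidom add minus le lt zero mul one
proof
  fix a b c
  show "a \<oplus> b \<oplus> c = a \<oplus> (b \<oplus> c)" by (rule add_assoc')
  show "a \<oplus> b = b \<oplus> a" by (rule add_commute')
  show "\<zero> \<oplus> a = a" by (rule zero_add)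
  show "a \<oplus> b \<ominus> a = b" by (rule add_minus)
  show "a \<ominus> b \<ominus> c = a \<ominus> (b \<oplus> c)" by (rule minus_minus)
  show "\<zero> \<otimes> a = \<zero>" "a \<otimes> \<zero> = \<zero>" by (rule zero_mul mul_zero)+
  show "a \<otimes> b \<otimes> c = a \<otimes> (b \<otimes> c)" by (rule mul_assoc')
  show "a \<otimes> b = b \<otimes> a" by (rule mul_commute')
  show "\<one> \<otimes> a = a" by (rule one_mul)
  show "(a \<oplus> b) \<otimes> c = a \<otimes> c \<oplus> b \<otimes> c" by (rule add_mul)
  show "a \<otimes> (b \<oplus> c) = a \<otimes> b \<oplus> a \<otimes> c" by (metis add_mul mul_commute')
  show "a \<otimes> (b \<ominus> c) = a \<otimes> b \<ominus> a \<otimes> c" by (rule mul_minus)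
  show "\<zero> \<noteq> \<one>" "\<zero> \<prec> \<one>" using zero_less_one less_irrefl' by auto
  show "a \<prec> b \<longleftrightarrow> a \<preceq> b \<and> \<not> b \<preceq> a" "a \<preceq> a" "a \<preceq> b \<or> b \<preceq> a"
    unfolding le_def using less_trans' less_irrefl' less_linear' by blast+
  show "a \<preceq> b \<Longrightarrow> b \<preceq> c \<Longrightarrow> a \<preceq> c" "a \<preceq> b \<Longrightarrow> b \<preceq> a \<Longrightarrow> a = b"
    unfolding le_def using less_trans' less_irrefl' by blast+
  show "a \<preceq> b \<Longrightarrow> c \<oplus> a \<preceq> c \<oplus> b"
    unfolding le_def by (metis add_commute' add_less_cancel')
  show "a \<prec> b \<Longrightarrow> \<zero> \<prec> c \<Longrightarrow> c \<otimes> a \<prec> c \<otimes> b" by (rule mul_less)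
  show "a \<noteq> \<zero> \<Longrightarrow> b \<noteq> \<zero> \<Longrightarrow> a \<otimes> b \<noteq> \<zero>"
    by (metis less_irrefl' mul_less mul_zero zero_less_or_eq)
  show "b \<preceq> a \<Longrightarrow> a \<ominus> b \<oplus> b = a"
    by (metis add_commute' add_minus le_iff_add)
qed

section \<open>Pairing\<close>

lemma zero_le [simp]: "\<zero> \<preceq> a"
  using zero_less_or_eq le_def by blast

lemma less_succ_iff_le [simp]: "a \<prec> b \<oplus> \<one> \<longleftrightarrow> a \<preceq> b"
  by (simp add: less_succ le_def)

lemma succ_le_iff: "a \<oplus> \<one> \<preceq> b \<longleftrightarrow> a \<prec> b"
  using less_succ_iff_le M.not_less by metis

lemma le_add': "b \<preceq> c \<oplus> b"
  using le_add by (simp add: M.add.commute)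

lemma le_square: "a \<preceq> a \<otimes> a"
proof (cases "a = \<zero>")
  case False
  then have "\<zero> \<prec> a" using zero_less_or_eq by auto
  then have "\<one> \<preceq> a" by (metis M.add_0_left succ_le_iff)
  then show ?thesis using M.mult_left_mono[of \<one> a a] by simp
qed auto

abbreviation pair :: "'a \<Rightarrow> 'a \<Rightarrow> 'a" where "pair \<equiv> pair_in M"

lemma fst_le_pair: "i \<preceq> pair i j"
  unfolding pair_in_def by (simp add: le_add M.add.commute)

lemma snd_le_pair: "j \<preceq> pair i j"
proof -
  have "j \<preceq> i \<oplus> j" by (simp add: le_add M.add.commute)
  also have "\<dots> \<preceq> (i \<oplus> j) \<otimes> (i \<oplus> j)" by (rule le_square)
  also have "\<dots> \<preceq> pair i j" unfolding pair_in_def by (rule le_add)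
  finally show ?thesis .
qed

lemma pair_mono: "i \<preceq> i' \<Longrightarrow> j \<preceq> j' \<Longrightarrow> pair i j \<preceq> pair i' j'"
  unfolding pair_in_def by (intro M.add_mono M.mult_mono) simp_all

text \<open>With \<open>s = i \<oplus> j\<close>, the square of \<open>s \<oplus> \<one>\<close>
  already exceeds \<open>pair i j\<close> and is at most the square of \<open>k \<oplus> l\<close>.
  Hence a code determines the sum of its components, which gives injectivity.\<close>

lemma pair_less: "i \<oplus> j \<prec> k \<oplus> l \<Longrightarrow> pair i j \<prec> pair k l"
proof -
  assume "i \<oplus> j \<prec> k \<oplus> l"
  then have "i \<oplus> j \<oplus> \<one> \<preceq> k \<oplus> l" by (simp add: succ_le_iff)
  then have "(i \<oplus> j \<oplus> \<one>) \<otimes> (i \<oplus> j \<oplus> \<one>) \<preceq> (k \<oplus> l) \<otimes> (k \<oplus> l)"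
    by (intro M.mult_mono) simp_all
  moreover have "(i \<oplus> j \<oplus> \<one>) \<otimes> (i \<oplus> j \<oplus> \<one>) = pair i j \<oplus> (i \<oplus> j \<oplus> j) \<oplus> \<one>"
    by (simp add: pair_in_def algebra_simps)
  ultimately have "pair i j \<oplus> (i \<oplus> j \<oplus> j) \<prec> (k \<oplus> l) \<otimes> (k \<oplus> l)"
    by (simp add: succ_le_iff)
  then show ?thesis
    using le_add[of "pair i j" "i \<oplus> j \<oplus> j"] le_add[of "(k \<oplus> l) \<otimes> (k \<oplus> l)" k]
    unfolding pair_in_def[of M k l] by order
qed

lemma pair_inject [simp]: "pair i j = pair k l \<longleftrightarrow> i = k \<and> j = l"
proof
  assume eq: "pair i j = pair k l"
  then have "i \<oplus> j = k \<oplus> l" using pair_less M.less_irrefl M.linorder_cases by metis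
  then show "i = k \<and> j = l" using eq unfolding pair_in_def by auto
qed auto

text \<open>The default \<zero> keeps the projection below its argument everywhere.\<close>

definition p1 :: "'a \<Rightarrow> 'a" where
  "p1 z = (if \<exists>i j. z = pair i j then THE i. \<exists>j. z = pair i j else \<zero>)"

definition p2 :: "'a \<Rightarrow> 'a" where
  "p2 z = (if \<exists>i j. z = pair i j then THE j. \<exists>i. z = pair i j else \<zero>)"

lemma p1_pair [simp]: "p1 (pair i j) = i" and p2_pair [simp]: "p2 (pair i j) = j"
  unfolding p1_def p2_def by auto

lemma p1_le: "p1 z \<preceq> z" and p2_le: "p2 z \<preceq> z"
proof -
  have "p1 z \<preceq> z \<and> p2 z \<preceq> z"
  proof (cases "\<exists>i j. z = pair i j")
    case True
    then show ?thesis using fst_le_pair snd_le_pair by auto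
  next
    case False
    then show ?thesis unfolding p1_def p2_def by simp
  qed
  then show "p1 z \<preceq> z" "p2 z \<preceq> z" by auto
qed

section \<open>Sets and functions of a model\<close>

text \<open>
  Relations of several arguments are treated as predicates of a tuple through the projections
  \<open>p1\<close> and \<open>p2\<close>, which are \<open>\<zero>\<close> off the range of \<open>pair\<close>, so that closure rules for
  \<open>rec\<close> and \<open>fn\<close> replace the manipulation of formulas.
\<close>

definition rec :: "('a \<Rightarrow> bool) \<Rightarrow> bool" where
  "rec P \<longleftrightarrow> {a. P a} \<in> sets_of M"

definition fn :: "('a \<Rightarrow> 'a) \<Rightarrow> bool" where
  "fn f \<longleftrightarrow> rec (\<lambda>z. \<exists>a. z = pair a (f a))"

definition set_params :: "'a set \<Rightarrow> 'a set \<Rightarrow> nat \<Rightarrow> 'a set" where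
  "set_params A B n = (if n = 0 then A else B)"

lemma set_params_simps [simp]: "set_params A B 0 = A" "set_params A B (Suc n) = B"
  by (simp_all add: set_params_def)

lemma set_assignment_params [simp]:
  "A \<in> sets_of M \<Longrightarrow> B \<in> sets_of M \<Longrightarrow> set_assignment M (set_params A B)"
  by (simp add: set_params_def set_assignment_def)

definition pair_term :: "num_term \<Rightarrow> num_term \<Rightarrow> num_term" where
  "pair_term s t = NAdd (NMul (NAdd s t) (NAdd s t)) s"

lemma term_val_pair_term [simp]: "term_val M e (pair_term s t) = pair (term_val M e s) (term_val M e t)"
  and term_vars_pair_term [simp]: "term_vars (pair_term s t) = term_vars s \<union> term_vars t"
  by (auto simp: pair_term_def pair_in_def)

definition bex :: "nat \<Rightarrow> num_term \<Rightarrow> arith_formula \<Rightarrow> arith_formula" where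
  "bex x t \<phi> = Exists x (Conj (Less (NVar x) (NAdd t NOne)) \<phi>)"

lemma delta0_bex [simp]: "delta0 \<phi> \<Longrightarrow> x \<notin> term_vars t \<Longrightarrow> delta0 (bex x t \<phi>)"
  by (simp add: bex_def)

lemma term_val_update [simp]: "x \<notin> term_vars t \<Longrightarrow> term_val M (e(x := a)) t = term_val M e t"
  by (induction t) auto

lemma sat_bex [simp]: "x \<notin> term_vars t \<Longrightarrow>
  sat M e S (bex x t \<phi>) \<longleftrightarrow> (\<exists>a. a \<preceq> term_val M e t \<and> sat M (e(x := a)) S \<phi>)"
  by (simp add: bex_def)

lemma delta0_rec:
  assumes "delta0 \<theta>" "\<And>e b. sat M (e(9 := b)) S \<theta> = sat M e S \<theta>" "set_assignment M S"
    "\<And>a. P a = sat M (e(0 := a)) S \<theta>"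
  shows "rec P"
  using delta0_comprehension[OF assms(1-3), of e] assms(4) by (simp add: rec_def)

lemma delta1_rec:
  assumes "delta0 \<theta>" "delta0 \<theta>'" "set_assignment M S"
    "\<And>a. P a = (\<exists>b. sat M (e(0 := a, 1 := b)) S \<theta>)" "\<And>a. P a = (\<forall>b. sat M (e(0 := a, 1 := b)) S \<theta>')"
  shows "rec P"
proof -
  have "\<forall>a. sat M (e(0 := a)) S (Exists 1 \<theta>) \<longleftrightarrow> sat M (e(0 := a)) S (Forall 1 \<theta>')"
    using assms(4,5) by simp
  then have "\<exists>A\<in>sets_of M. \<forall>a. a \<in> A \<longleftrightarrow> sat M (e(0 := a)) S (Exists 1 \<theta>)"
    using delta1_comprehension[unfolded delta1_comprehension_def, rule_format, of "Exists 1 \<theta>" "Forall 1 \<theta>'" S e 0]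
      assms(1-3) by (auto simp: sigma1_def pi1_def)
  moreover have "sat M (e(0 := a)) S (Exists 1 \<theta>) \<longleftrightarrow> P a" for a using assms(4) by simp
  ultimately obtain A where "A \<in> sets_of M" "\<forall>a. a \<in> A \<longleftrightarrow> P a" by auto
  moreover from this(2) have "{a. P a} = A" by auto
  ultimately show ?thesis by (simp add: rec_def)
qed

lemma rec_mem: "A \<in> sets_of M \<Longrightarrow> rec (\<lambda>a. a \<in> A)"
  by (simp add: rec_def)

section \<open>Closure properties of \<open>rec\<close> and \<open>fn\<close>\<close>

text \<open>The value \<open>f a\<close> has no bound in terms of \<open>a\<close>. It is named by
  an unbounded quantifier, once as \<open>b = f a\<close> and \<open>P b\<close> for some
  \<open>b\<close>, once as \<open>b = f a\<close> implies \<open>P b\<close> for all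
  \<open>b\<close>, which is a \<open>\<Delta>\<^sup>0\<^sub>1\<close> definition.\<close>

lemma rec_compose:
  assumes "rec P" "fn f"
  shows "rec (\<lambda>a. P (f a))"
  by (rule delta1_rec[of "Conj (Mem (pair_term (NVar 0) (NVar 1)) 0) (Mem (NVar 1) 1)"
        "Impl (Mem (pair_term (NVar 0) (NVar 1)) 0) (Mem (NVar 1) 1)"
        "set_params {z. \<exists>a. z = pair a (f a)} {a. P a}"])
    (use assms in \<open>auto simp: fn_def rec_def\<close>)

lemma rec_not: "rec P \<Longrightarrow> rec (\<lambda>a. \<not> P a)"
  by (rule delta0_rec[of "Neg (Mem (NVar 0) 0)" "set_params {a. P a} {a. P a}"]) (auto simp: rec_def)

lemma rec_conj: "rec P \<Longrightarrow> rec Q \<Longrightarrow> rec (\<lambda>a. P a \<and> Q a)"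
  by (rule delta0_rec[of "Conj (Mem (NVar 0) 0) (Mem (NVar 0) 1)" "set_params {a. P a} {a. Q a}"])
    (auto simp: rec_def)

lemma rec_const: "rec (\<lambda>a. c)"
proof -
  obtain A where "A \<in> sets_of M" using sets_nonempty by blast
  then have "rec (\<lambda>a. a \<in> A \<and> \<not> a \<in> A)" by (intro rec_conj rec_not rec_mem)
  then have "rec (\<lambda>a. False)" by simp
  with rec_not[OF this] show ?thesis by (cases c) simp_all
qed

lemma rec_disj:
  assumes "rec P" "rec Q" shows "rec (\<lambda>a. P a \<or> Q a)"
  using rec_not[OF rec_conj[OF rec_not rec_not, OF assms]] by simp

lemma rec_imp:
  assumes "rec P" "rec Q" shows "rec (\<lambda>a. P a \<longrightarrow> Q a)"
  using rec_disj[OF rec_not, OF assms] by (simp only: imp_conv_disj)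

lemma rec_iff:
  assumes "rec P" "rec Q" shows "rec (\<lambda>a. P a \<longleftrightarrow> Q a)"
  using rec_conj[OF rec_imp rec_imp, OF assms assms(2,1)] by (simp only: iff_conv_conj_imp)

lemma delta0_rec_pure:
  assumes "delta0 \<theta>" "\<And>e b S. sat M (e(9 := b)) S \<theta> = sat M e S \<theta>"
    "\<And>a S. P a = sat M (e(0 := a)) S \<theta>"
  shows "rec P"
  using ex_set_assignment delta0_rec[OF assms(1,2) _ assms(3)] by blast

lemma fn_id: "fn (\<lambda>a. a)"
  unfolding fn_def
  by (rule delta0_rec_pure[of "bex 2 (NVar 0) (Equal (NVar 0) (pair_term (NVar 2) (NVar 2)))" _ "params \<zero> \<zero>"])
    (auto simp: fst_le_pair)

lemma fn_const: "fn (\<lambda>a. c)"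
  unfolding fn_def
  by (rule delta0_rec_pure[of "bex 2 (NVar 0) (Equal (NVar 0) (pair_term (NVar 2) (NVar 1)))" _ "params c \<zero>"])
    (auto simp: fst_le_pair)

lemma fn_pair:
  assumes "fn f" "fn g"
  shows "fn (\<lambda>a. pair (f a) (g a))"
proof -
  have *: "(\<exists>a. z = pair a (pair (f a) (g a))) \<longleftrightarrow>
    (\<exists>a. a \<preceq> z \<and> (\<exists>b. b \<preceq> z \<and> (\<exists>c. c \<preceq> z \<and> z = pair a (pair b c) \<and> b = f a \<and> c = g a)))" for z
    using M.order_trans[OF fst_le_pair snd_le_pair] M.order_trans[OF snd_le_pair snd_le_pair]
    by (auto simp: fst_le_pair)
  show ?thesis unfolding fn_def
    by (rule delta0_rec[of "bex 2 (NVar 0) (bex 3 (NVar 0) (bex 4 (NVar 0)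
        (Conj (Equal (NVar 0) (pair_term (NVar 2) (pair_term (NVar 3) (NVar 4))))
         (Conj (Mem (pair_term (NVar 2) (NVar 3)) 0) (Mem (pair_term (NVar 2) (NVar 4)) 1)))))"
        "set_params {z. \<exists>a. z = pair a (f a)} {z. \<exists>a. z = pair a (g a)}"])
     (use assms in \<open>simp_all add: fn_def rec_def *\<close>)
qed

text \<open>The intermediate value \<open>f a\<close> is not bounded by the code of the pair, so it
  is quantified in both ways as in \<open>rec_compose\<close>.\<close>

lemma fn_compose:
  assumes "fn f" "fn g"
  shows "fn (\<lambda>a. g (f a))"
proof -
  have *: "(\<exists>a. z = pair a (g (f a))) \<longleftrightarrow>
      (\<exists>b. \<exists>a. a \<preceq> z \<and> (\<exists>c. c \<preceq> z \<and> z = pair a c \<and> b = f a \<and> c = g b))"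
    "(\<exists>a. z = pair a (g (f a))) \<longleftrightarrow>
      (\<forall>b. \<exists>a. a \<preceq> z \<and> (\<exists>c. c \<preceq> z \<and> z = pair a c \<and> (b = f a \<longrightarrow> c = g b)))" for z
    by (cases "\<exists>a c. z = pair a c"; auto simp: fst_le_pair snd_le_pair)+
  let ?f = "\<lambda>\<theta>. bex 2 (NVar 0) (bex 3 (NVar 0) (Conj (Equal (NVar 0) (pair_term (NVar 2) (NVar 3))) \<theta>))"
  show ?thesis unfolding fn_def
    by (rule delta1_rec[of
       "?f (Conj (Mem (pair_term (NVar 2) (NVar 1)) 0) (Mem (pair_term (NVar 1) (NVar 3)) 1))"
       "?f (Impl (Mem (pair_term (NVar 2) (NVar 1)) 0) (Mem (pair_term (NVar 1) (NVar 3)) 1))"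
        "set_params {z. \<exists>a. z = pair a (f a)} {z. \<exists>a. z = pair a (g a)}"],
       use assms in \<open>simp add: fn_def rec_def\<close>, use assms in \<open>simp add: fn_def rec_def\<close>, use assms in \<open>simp add: fn_def rec_def\<close>)
     (rule trans, rule *, simp)+
qed

lemma p1_eq_iff: "p1 a = i \<longleftrightarrow> (\<exists>j. a = pair i j) \<or> i = \<zero> \<and> \<not> (\<exists>i j. a = pair i j)"
  and p2_eq_iff: "p2 a = j \<longleftrightarrow> (\<exists>i. a = pair i j) \<or> j = \<zero> \<and> \<not> (\<exists>i j. a = pair i j)"
  by (cases "\<exists>i j. a = pair i j"; auto simp: p1_def p2_def)+

text \<open>All quantifiers in the definition of a projection, including those of the default case,
  can be bounded by the number that codes argument and value.\<close>

lemma fn_p1: "fn p1" and fn_p2: "fn p2"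
proof -
  have bound: "i \<preceq> z" "j \<preceq> z" if "a \<preceq> z" "a = pair i j" for a i j z
    using that fst_le_pair[of i j] snd_le_pair[of j i] by order+
  have graph: "(\<exists>a. z = pair a (f a)) \<longleftrightarrow> (\<exists>a. a \<preceq> z \<and> (\<exists>i. i \<preceq> z \<and> z = pair a i \<and>
      (Q a i \<or> i = \<zero> \<and> \<not> (\<exists>i. i \<preceq> z \<and> (\<exists>j. j \<preceq> z \<and> a = pair i j)))))"
    if "\<And>a i. a \<preceq> z \<Longrightarrow> f a = i \<longleftrightarrow> Q a i \<or> i = \<zero> \<and> \<not> (\<exists>i j. a = pair i j)"
    for z f Q
  proof -
    have "(\<exists>i j. a = pair i j) \<longleftrightarrow> (\<exists>i. i \<preceq> z \<and> (\<exists>j. j \<preceq> z \<and> a = pair i j))" if "a \<preceq> z" for a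
      using bound[OF that] by blast
    then have "f a = i \<longleftrightarrow> Q a i \<or> i = \<zero> \<and> \<not> (\<exists>i. i \<preceq> z \<and> (\<exists>j. j \<preceq> z \<and> a = pair i j))"
      if "a \<preceq> z" for a i
      using that \<open>\<And>a i. a \<preceq> z \<Longrightarrow> f a = i \<longleftrightarrow> _ a i\<close> by simp
    moreover have "(\<exists>a. z = pair a (f a)) \<longleftrightarrow> (\<exists>a. a \<preceq> z \<and> (\<exists>i. i \<preceq> z \<and> z = pair a i \<and> f a = i))"
      using fst_le_pair snd_le_pair by blast
    ultimately show ?thesis by (simp cong: conj_cong)
  qed
  have 1: "p1 a = i \<longleftrightarrow> (\<exists>j. j \<preceq> z \<and> a = pair i j) \<or> i = \<zero> \<and> \<not> (\<exists>i j. a = pair i j)"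
    and 2: "p2 a = i \<longleftrightarrow> (\<exists>j. j \<preceq> z \<and> a = pair j i) \<or> i = \<zero> \<and> \<not> (\<exists>i j. a = pair i j)"
    if "a \<preceq> z" for a i z
    using p1_eq_iff p2_eq_iff bound[OF that] by metis+
  let ?graph = "\<lambda>\<theta>. bex 2 (NVar 0) (bex 3 (NVar 0) (Conj (Equal (NVar 0) (pair_term (NVar 2) (NVar 3)))
      (Disj (bex 4 (NVar 0) (Equal (NVar 2) \<theta>)) (Conj (Equal (NVar 3) NZero)
        (Neg (bex 4 (NVar 0) (bex 5 (NVar 0) (Equal (NVar 2) (pair_term (NVar 4) (NVar 5))))))))))"
  show "fn p1"
    unfolding fn_def
    by (rule delta0_rec_pure[of "?graph (pair_term (NVar 3) (NVar 4))" _ "params \<zero> \<zero>"],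
      simp, simp, subst graph[OF 1], assumption, simp)
  show "fn p2"
    unfolding fn_def
    by (rule delta0_rec_pure[of "?graph (pair_term (NVar 4) (NVar 3))" _ "params \<zero> \<zero>"],
      simp, simp, subst graph[OF 2], assumption, simp)
qed

lemma rec_is_pair: "rec (\<lambda>z. z = pair (p1 z) (p2 z))"
proof -
  have *: "z = pair (p1 z) (p2 z) \<longleftrightarrow> (\<exists>i. i \<preceq> z \<and> (\<exists>j. j \<preceq> z \<and> z = pair i j))" for z
    using p1_le[of z] p2_le[of z] by auto
  show ?thesis
    by (rule delta0_rec_pure[of "bex 4 (NVar 0) (bex 5 (NVar 0) (Equal (NVar 0) (pair_term (NVar 4) (NVar 5))))"
          _ "params \<zero> \<zero>"], simp, simp, subst *, simp)
qed

lemma fnI: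
  assumes "rec (\<lambda>z. f (p1 z) = p2 z)"
  shows "fn f"
proof -
  have "(\<exists>a. z = pair a (f a)) \<longleftrightarrow> z = pair (p1 z) (p2 z) \<and> f (p1 z) = p2 z" for z
    by (metis p1_pair p2_pair)
  then show ?thesis
    unfolding fn_def using rec_conj[OF rec_is_pair assms] by simp
qed

lemma rec_eq:
  assumes "fn f" "fn g"
  shows "rec (\<lambda>a. f a = g a)"
proof -
  have "rec (\<lambda>u. \<exists>i. u = pair i i)"
    using fn_id by (simp add: fn_def)
  from rec_compose[OF this fn_pair[OF assms(2,1)]] show ?thesis by simp
qed

lemma rec_less:
  assumes "fn f" "fn g"
  shows "rec (\<lambda>a. f a \<prec> g a)"
proof -
  have *: "(\<exists>i j. u = pair i j \<and> i \<prec> j) \<longleftrightarrow> (\<exists>i. i \<preceq> u \<and> (\<exists>j. j \<preceq> u \<and> u = pair i j \<and> i \<prec> j))" for u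
    using fst_le_pair snd_le_pair by blast
  have "rec (\<lambda>u. \<exists>i j. u = pair i j \<and> i \<prec> j)"
    by (rule delta0_rec_pure[of "bex 4 (NVar 0) (bex 5 (NVar 0) (Conj (Equal (NVar 0) (pair_term (NVar 4) (NVar 5)))
          (Less (NVar 4) (NVar 5))))" _ "params \<zero> \<zero>"], simp, simp, subst *, simp)
  from rec_compose[OF this fn_pair[OF assms]] show ?thesis by simp
qed

lemma rec_le: "fn f \<Longrightarrow> fn g \<Longrightarrow> rec (\<lambda>a. f a \<preceq> g a)"
  unfolding le_def by (intro rec_disj rec_less rec_eq)

lemma fn_add_mul:
  assumes "fn f" "fn g"
  shows fn_add: "fn (\<lambda>a. f a \<oplus> g a)" and fn_mul: "fn (\<lambda>a. f a \<otimes> g a)"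
proof -
  have fn: "fn (\<lambda>z. pair (pair (f (p1 z)) (g (p1 z))) (p2 z))"
    by (intro fn_pair fn_compose[OF fn_p1 assms(1)] fn_compose[OF fn_p1 assms(2)] fn_p2)
  have *: "(\<exists>i j k. u = pair (pair i j) k \<and> h i j = k) \<longleftrightarrow>
    (\<exists>i. i \<preceq> u \<and> (\<exists>j. j \<preceq> u \<and> (\<exists>k. k \<preceq> u \<and> u = pair (pair i j) k \<and> h i j = k)))" for u h
    using M.order_trans[OF fst_le_pair fst_le_pair] M.order_trans[OF snd_le_pair fst_le_pair]
    by (auto simp: snd_le_pair)
  let ?graph = "\<lambda>t. bex 4 (NVar 0) (bex 5 (NVar 0) (bex 3 (NVar 0) (Conj
    (Equal (NVar 0) (pair_term (pair_term (NVar 4) (NVar 5)) (NVar 3))) (Equal t (NVar 3)))))"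
  have "rec (\<lambda>u. \<exists>i j k. u = pair (pair i j) k \<and> i \<oplus> j = k)"
    by (rule delta0_rec_pure[of "?graph (NAdd (NVar 4) (NVar 5))" _ "params \<zero> \<zero>"], simp, simp, subst *, simp)
  from rec_compose[OF this fn] show "fn (\<lambda>a. f a \<oplus> g a)" by (intro fnI) simp
  have "rec (\<lambda>u. \<exists>i j k. u = pair (pair i j) k \<and> i \<otimes> j = k)"
    by (rule delta0_rec_pure[of "?graph (NMul (NVar 4) (NVar 5))" _ "params \<zero> \<zero>"], simp, simp, subst *, simp)
  from rec_compose[OF this fn] show "fn (\<lambda>a. f a \<otimes> g a)" by (intro fnI) simp
qed

text \<open>The bound \<open>f a\<close> is a function value and not a term, so it is named by an
  existential and by a universal quantifier as in \<open>rec_compose\<close>.\<close>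

lemma rec_bex:
  assumes "rec (\<lambda>z. Q (p1 z) (p2 z))" "fn f"
  shows "rec (\<lambda>a. \<exists>b. b \<prec> f a \<and> Q a b)"
proof -
  have rec: "rec (\<lambda>z. Q (p1 z) (p2 z))" "rec (\<lambda>z. \<exists>a. z = pair a (f a))"
    using assms by (simp_all add: fn_def)
  let ?\<theta> = "Exists 2 (Conj (Less (NVar 2) (NVar 1)) (Mem (pair_term (NVar 0) (NVar 2)) 1))"
  show ?thesis
    by (rule delta1_rec[of
       "Conj (Mem (pair_term (NVar 0) (NVar 1)) 0) ?\<theta>"
       "Impl (Mem (pair_term (NVar 0) (NVar 1)) 0) ?\<theta>"
        "set_params {z. \<exists>a. z = pair a (f a)} {z. Q (p1 z) (p2 z)}"])
      (use rec in \<open>simp_all add: rec_def\<close>)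
qed

lemma rec_ball:
  assumes "rec (\<lambda>z. Q (p1 z) (p2 z))" "fn f"
  shows "rec (\<lambda>a. \<forall>b. b \<prec> f a \<longrightarrow> Q a b)"
  using rec_not[OF rec_bex[OF rec_not[OF assms(1)] assms(2)]] by simp

lemma rec_mem_fn: "A \<in> sets_of M \<Longrightarrow> fn f \<Longrightarrow> rec (\<lambda>a. f a \<in> A)"
  using rec_compose[OF rec_mem] .

lemma fn_p1_comp: "fn f \<Longrightarrow> fn (\<lambda>a. p1 (f a))" and fn_p2_comp: "fn f \<Longrightarrow> fn (\<lambda>a. p2 (f a))"
  using fn_compose fn_p1 fn_p2 by blast+

lemmas rec_intros = fn_const fn_id fn_p1_comp fn_p2_comp fn_pair fn_add fn_mul
  rec_const rec_mem_fn rec_eq rec_less rec_le rec_bex rec_ball rec_not rec_conj rec_disj rec_imp rec_iff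

lemma rec2:
  assumes "rec (\<lambda>z. P (p1 z) (p2 z))" "fn f" "fn g"
  shows "rec (\<lambda>a. P (f a) (g a))"
  using rec_compose[OF assms(1) fn_pair[OF assms(2,3)]] by simp

lemma rec3:
  assumes "rec (\<lambda>z. P (p1 (p1 z)) (p2 (p1 z)) (p2 z))" "fn f" "fn g" "fn h"
  shows "rec (\<lambda>a. P (f a) (g a) (h a))"
  using rec_compose[OF assms(1) fn_pair[OF fn_pair[OF assms(2,3)] assms(4)]] by simp

text \<open>\<open>\<Sigma>\<^sup>0\<^sub>1\<close> induction with the matrix given by a set of
  \<open>M\<close>; the set serves as the parameter of one fixed formula.\<close>

lemma sigma1_induct:
  assumes rec: "rec (\<lambda>z. R (p1 z) (p2 z))" and "\<exists>b. R \<zero> b" "\<And>a b. R a b \<Longrightarrow> \<exists>b. R (a \<oplus> \<one>) b"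
  shows "\<exists>b. R a b"
proof -
  define \<phi> where "\<phi> = Exists 1 (Mem (pair_term (NVar 0) (NVar 1)) 0)"
  define A where "A = {z. R (p1 z) (p2 z)}"
  have "sigma1 \<phi>" by (auto simp: sigma1_def \<phi>_def)
  moreover have "set_assignment M (\<lambda>_. A)" using rec by (simp add: set_assignment_def rec_def A_def)
  moreover have sat: "sat M (e(0 := a)) (\<lambda>_. A) \<phi> \<longleftrightarrow> (\<exists>b. R a b)" for e a
    by (simp add: \<phi>_def A_def)
  ultimately have "\<forall>a. sat M ((\<lambda>_. \<zero>)(0 := a)) (\<lambda>_. A) \<phi>"
    using sigma1_induction[unfolded sigma1_induction_def, rule_format, of \<phi> "\<lambda>_. A" "\<lambda>_. \<zero>" 0] assms(2,3)
    by (simp only: sat) blast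
  then show ?thesis by (simp only: sat)
qed

section \<open>Codes of finite sets\<close>

text \<open>A nonzero divisor has its cofactor below the multiple; for the divisor \<zero> the
  cofactor \<zero> serves. Bounding the cofactor makes divisibility accessible to
  \<open>rec_bex\<close>.\<close>

lemma dvd_iff_bounded: "M.dvd a b \<longleftrightarrow> (\<exists>c. c \<prec> b \<oplus> \<one> \<and> b = a \<otimes> c)"
proof
  assume "M.dvd a b"
  then obtain c where c: "b = a \<otimes> c" by blast
  show "\<exists>c. c \<prec> b \<oplus> \<one> \<and> b = a \<otimes> c"
  proof (cases "a = \<zero>")
    case True
    then show ?thesis using c by (intro exI[of _ \<zero>]) simp
  next
    case False
    then have "\<one> \<otimes> c \<preceq> a \<otimes> c"
      by (intro M.mult_right_mono) (metis M.add_0_left succ_le_iff zero_less_or_eq, simp)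
    then show ?thesis using c by auto
  qed
qed auto

lemma rec_dvd: "fn f \<Longrightarrow> fn g \<Longrightarrow> rec (\<lambda>a. M.dvd (f a) (g a))"
proof (rule rec2)
  show "rec (\<lambda>z. M.dvd (p1 z) (p2 z))"
    unfolding dvd_iff_bounded by (intro rec_intros)
qed

text \<open>A substitute for the factorial: each induction step multiplies by the next nonzero
  number, and only the existence of some multiple is carried along.\<close>

lemma ex_common_multiple: "\<exists>d. \<zero> \<prec> d \<and> (\<forall>x. x \<prec> b \<longrightarrow> \<zero> \<prec> x \<longrightarrow> M.dvd x d)"
proof (rule sigma1_induct[where R = "\<lambda>b d. \<zero> \<prec> d \<and> (\<forall>x. x \<prec> b \<longrightarrow> \<zero> \<prec> x \<longrightarrow> M.dvd x d)"])
  show "rec (\<lambda>z. \<zero> \<prec> p2 z \<and> (\<forall>x. x \<prec> p1 z \<longrightarrow> \<zero> \<prec> x \<longrightarrow> M.dvd x (p2 z)))"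
    by (intro rec_intros rec_dvd)
  show "\<exists>d. \<zero> \<prec> d \<and> (\<forall>x. x \<prec> \<zero> \<longrightarrow> \<zero> \<prec> x \<longrightarrow> M.dvd x d)"
    using zero_less_one not_less_zero by blast
next
  fix b d assume *: "\<zero> \<prec> d \<and> (\<forall>x. x \<prec> b \<longrightarrow> \<zero> \<prec> x \<longrightarrow> M.dvd x d)"
  show "\<exists>d. \<zero> \<prec> d \<and> (\<forall>x. x \<prec> b \<oplus> \<one> \<longrightarrow> \<zero> \<prec> x \<longrightarrow> M.dvd x d)"
  proof (cases "b = \<zero>")
    case True
    then show ?thesis using * by (metis M.leD less_succ_iff_le)
  next
    case False
    then have "\<zero> \<prec> d \<otimes> b" using * M.mult_pos_pos zero_less_or_eq by metis
    moreover have "M.dvd x (d \<otimes> b)" if "x \<prec> b \<oplus> \<one>" "\<zero> \<prec> x" for x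
      using that * less_succ M.dvd_mult2[of x d b] by (cases "x = b") auto
    ultimately show ?thesis by blast
  qed
qed

lemmas semiring_laws = M.distrib_left M.distrib_right M.mult_1_left M.mult_1_right
  M.add.assoc M.add.commute M.add.left_commute M.mult.assoc M.mult.commute M.mult.left_commute

text \<open>These are the moduli of Goedel's beta function.\<close>

definition modulus :: "'a \<Rightarrow> 'a \<Rightarrow> 'a" where
  "modulus d x = (x \<oplus> \<one>) \<otimes> d \<oplus> \<one>"

text \<open>The number \<open>t\<close> is invertible modulo \<open>p\<close>: both
  \<open>c \<otimes> t \<otimes> s\<close> and
  \<open>c \<otimes> t \<otimes> s \<oplus> c = c \<otimes> p\<close> are multiples of
  \<open>p\<close>, hence so is \<open>c\<close>.\<close>

lemma dvd_cancel_unit: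
  assumes "M.dvd p (c \<otimes> t)" "p = t \<otimes> s \<oplus> \<one>"
  shows "M.dvd p c"
proof -
  have "M.dvd p (c \<otimes> t \<otimes> s)" using assms(1) by (rule M.dvd_mult2)
  moreover have "M.dvd p (c \<otimes> t \<otimes> s \<oplus> c)"
    by (rule M.dvdI[of _ _ c]) (simp only: assms(2) semiring_laws)
  ultimately show ?thesis using M.dvd_add_right_iff by blast
qed

text \<open>Two moduli differ by \<open>d\<close> times the distance of \<open>x\<close> and
  \<open>y\<close>. That distance is positive and below \<open>b\<close>, so it divides
  \<open>d\<close>, and both factors are cancelled by \<open>dvd_cancel_unit\<close>.\<close>

lemma modulus_coprime:
  assumes "M.dvd (modulus d x) (c \<otimes> modulus d y)" "x \<noteq> y" "x \<prec> b" "y \<prec> b"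
    and d: "\<And>u. u \<prec> b \<Longrightarrow> \<zero> \<prec> u \<Longrightarrow> M.dvd u d"
  shows "M.dvd (modulus d x) c"
proof -
  \<comment> \<open>\<open>u\<close> is the distance of \<open>x\<close> and \<open>y\<close>; both \<open>u\<close> and \<open>d\<close> are units modulo \<open>modulus d x\<close>.\<close>
  obtain u where u: "M.dvd u d" "M.dvd (modulus d x) (c \<otimes> u \<otimes> d)"
  proof (cases "x \<prec> y")
    case True
    then obtain u where u: "y = x \<oplus> (u \<oplus> \<one>)" using less_imp_ex by metis
    have "modulus d y = modulus d x \<oplus> (u \<oplus> \<one>) \<otimes> d" by (simp only: u modulus_def semiring_laws)
    then have "c \<otimes> modulus d y = modulus d x \<otimes> c \<oplus> c \<otimes> (u \<oplus> \<one>) \<otimes> d" by (simp only: semiring_laws)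
    then have "M.dvd (modulus d x) (c \<otimes> (u \<oplus> \<one>) \<otimes> d)"
      using assms(1) M.dvd_add_right_iff[of "modulus d x" "modulus d x \<otimes> c"] by simp
    moreover have "u \<oplus> \<one> \<preceq> y" by (simp add: u le_add M.add.commute)
    then have "M.dvd (u \<oplus> \<one>) d" using assms(4) by (intro d) (order, simp)
    ultimately show ?thesis by (intro that)
  next
    case False
    then have "y \<prec> x" using assms(2) by order
    then obtain u where u: "x = y \<oplus> (u \<oplus> \<one>)" using less_imp_ex by metis
    have "modulus d x = modulus d y \<oplus> (u \<oplus> \<one>) \<otimes> d" by (simp only: u modulus_def semiring_laws)
    then have "modulus d x \<otimes> c = c \<otimes> modulus d y \<oplus> c \<otimes> (u \<oplus> \<one>) \<otimes> d" by (simp only: semiring_laws)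
    then have "M.dvd (modulus d x) (c \<otimes> (u \<oplus> \<one>) \<otimes> d)"
      using assms(1) M.dvd_add_right_iff M.dvd_triv_left by metis
    moreover have "u \<oplus> \<one> \<preceq> x" by (simp add: u le_add M.add.commute)
    then have "M.dvd (u \<oplus> \<one>) d" using assms(3) by (intro d) (order, simp)
    ultimately show ?thesis by (intro that)
  qed
  have "M.dvd (modulus d x) (c \<otimes> u)"
    by (rule dvd_cancel_unit[OF u(2), of "x \<oplus> \<one>"]) (simp only: modulus_def semiring_laws)
  moreover obtain w where "d = u \<otimes> w" using u(1) by blast
  then have "modulus d x = u \<otimes> (w \<otimes> (x \<oplus> \<one>)) \<oplus> \<one>" by (simp only: modulus_def semiring_laws)
  ultimately show ?thesis by (rule dvd_cancel_unit)
qed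

text \<open>The number \<open>q = (b, (c, d))\<close> codes a set of numbers below \<open>b\<close>.\<close>

definition el :: "'a \<Rightarrow> 'a \<Rightarrow> bool" where
  "el x q \<longleftrightarrow> x \<prec> p1 q \<and> M.dvd (modulus (p2 (p2 q)) x) (p1 (p2 q))"

lemma el_less: "el x q \<Longrightarrow> x \<prec> q"
  using M.less_le_trans[OF _ p1_le] by (auto simp: el_def)

lemma rec_el: "fn f \<Longrightarrow> fn g \<Longrightarrow> rec (\<lambda>a. el (f a) (g a))"
  unfolding el_def modulus_def by (intro rec_intros rec_dvd)

text \<open>The code contains the product of the moduli of all \<open>x\<close> with
  \<open>P x\<close>. It is built by induction on \<open>k\<close>, one candidate factor at a time;
  by \<open>modulus_coprime\<close> a new factor does not affect divisibility by the other
  moduli.\<close>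

lemma ex_code:
  assumes "rec P" "\<And>x. P x \<Longrightarrow> x \<prec> b"
  shows "\<exists>q. \<forall>x. el x q \<longleftrightarrow> P x"
proof -
  obtain d where d: "\<zero> \<prec> d" "\<And>x. x \<prec> b \<Longrightarrow> \<zero> \<prec> x \<Longrightarrow> M.dvd x d"
    using ex_common_multiple by blast
  have "\<exists>c. \<forall>x. x \<prec> b \<longrightarrow> (M.dvd (modulus d x) c \<longleftrightarrow> P x \<and> x \<prec> b)"
  proof (rule sigma1_induct[where R = "\<lambda>k c. \<forall>x. x \<prec> b \<longrightarrow> (M.dvd (modulus d x) c \<longleftrightarrow> P x \<and> x \<prec> k)"])
    show "rec (\<lambda>z. \<forall>x. x \<prec> b \<longrightarrow> (M.dvd (modulus d x) (p2 z) \<longleftrightarrow> P x \<and> x \<prec> p1 z))"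
      unfolding modulus_def by (intro rec_intros rec_dvd rec_compose[OF assms(1) fn_p2])
    \<comment> \<open>The empty product is \<one>; every modulus exceeds it because \<open>d\<close>
      is positive.\<close>
    have "\<not> M.dvd (modulus d x) \<one>" for x
    proof
      assume "M.dvd (modulus d x) \<one>"
      then have "modulus d x \<preceq> \<one>" unfolding dvd_iff_bounded
        by (metis M.mult_1 M.mult_eq_0_iff M.mult_right_mono M.zero_neq_one succ_le_iff zero_le zero_less_or_eq M.mult.commute M.add_0_left)
      moreover have "\<zero> \<prec> (x \<oplus> \<one>) \<otimes> d" using d by (intro M.mult_pos_pos) simp_all
      ultimately show False by (simp add: modulus_def succ_le_iff)
    qed
    then show "\<exists>c. \<forall>x. x \<prec> b \<longrightarrow> (M.dvd (modulus d x) c \<longleftrightarrow> P x \<and> x \<prec> \<zero>)"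
      by (intro exI[of _ \<one>]) (simp add: not_less_zero)
  next
    fix k c assume IH: "\<forall>x. x \<prec> b \<longrightarrow> (M.dvd (modulus d x) c \<longleftrightarrow> P x \<and> x \<prec> k)"
    define c' where "c' = (if P k then c \<otimes> modulus d k else c)"
    have "M.dvd (modulus d x) c' \<longleftrightarrow> P x \<and> x \<prec> k \<oplus> \<one>" if "x \<prec> b" for x
    proof (cases "x = k")
      case True
      then show ?thesis using IH that by (simp add: c'_def)
    next
      case False
      have "M.dvd (modulus d x) c' \<longleftrightarrow> M.dvd (modulus d x) c"
        using modulus_coprime[of d x c k b, OF _ False that assms(2) d(2)] M.dvd_mult2
        unfolding c'_def by (cases "P k") auto
      then show ?thesis using IH that False by (simp add: le_def)
    qed
    then show "\<exists>c. \<forall>x. x \<prec> b \<longrightarrow> (M.dvd (modulus d x) c \<longleftrightarrow> P x \<and> x \<prec> k \<oplus> \<one>)" by blast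
  qed
  then obtain c where "\<And>x. x \<prec> b \<Longrightarrow> M.dvd (modulus d x) c \<longleftrightarrow> P x" by blast
  then have "el x (pair b (pair c d)) \<longleftrightarrow> P x" for x
    unfolding el_def using assms(2) by auto
  then show ?thesis by blast
qed

section \<open>Collection and the pigeonhole principle\<close>

text \<open>\<open>\<Sigma>\<^sup>0\<^sub>1\<close> bounding: induction on \<open>l\<close> enlarges
  the bound by a witness for one further argument. The guard \<open>a \<prec> k\<close> stays inside
  the statement, so that the induction may run past \<open>k\<close>.\<close>

lemma collection:
  assumes rec: "rec (\<lambda>z. R (p1 z) (p2 z))" and ex: "\<And>a. a \<prec> k \<Longrightarrow> \<exists>b. R a b"
  shows "\<exists>s. \<forall>a. a \<prec> k \<longrightarrow> (\<exists>b. b \<prec> s \<and> R a b)"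
proof -
  have "\<exists>s. \<forall>a. a \<prec> k \<longrightarrow> a \<prec> k \<longrightarrow> (\<exists>b. b \<prec> s \<and> R a b)"
  proof (rule sigma1_induct[where R = "\<lambda>l s. \<forall>a. a \<prec> l \<longrightarrow> a \<prec> k \<longrightarrow> (\<exists>b. b \<prec> s \<and> R a b)"])
    have "fn (\<lambda>z. pair (p2 (p1 z)) (p2 z))" by (intro rec_intros)
    from rec_compose[OF rec this]
    show "rec (\<lambda>z. \<forall>a. a \<prec> p1 z \<longrightarrow> a \<prec> k \<longrightarrow> (\<exists>b. b \<prec> p2 z \<and> R a b))"
      by (intro rec_intros) simp
    show "\<exists>s. \<forall>a. a \<prec> \<zero> \<longrightarrow> a \<prec> k \<longrightarrow> (\<exists>b. b \<prec> s \<and> R a b)"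
      using not_less_zero by blast
  next
    fix l s assume IH: "\<forall>a. a \<prec> l \<longrightarrow> a \<prec> k \<longrightarrow> (\<exists>b. b \<prec> s \<and> R a b)"
    obtain b where b: "l \<prec> k \<Longrightarrow> R l b" using ex by blast
    have "\<exists>b'. b' \<prec> s \<oplus> b \<oplus> \<one> \<and> R a b'" if a: "a \<prec> l \<oplus> \<one>" "a \<prec> k" for a
    proof (cases "a = l")
      case True
      moreover have "b \<prec> s \<oplus> b \<oplus> \<one>" by (simp add: le_add')
      ultimately show ?thesis using b a(2) by blast
    next
      case False
      then obtain b' where "b' \<prec> s" "R a b'" using IH a unfolding less_succ by blast
      moreover have "s \<preceq> s \<oplus> b \<oplus> \<one>" using le_add[of s] by (simp add: M.add.assoc)
      ultimately show ?thesis using M.less_le_trans by blast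
    qed
    then show "\<exists>s. \<forall>a. a \<prec> l \<oplus> \<one> \<longrightarrow> a \<prec> k \<longrightarrow> (\<exists>b. b \<prec> s \<and> R a b)" by blast
  qed
  then show ?thesis by blast
qed

text \<open>An injective multivalued map from the numbers up to \<open>n\<close> into the numbers below \<open>n\<close>.\<close>

definition coded_injection :: "'a \<Rightarrow> 'a \<Rightarrow> bool" where
  "coded_injection q n \<longleftrightarrow> (\<forall>i. i \<prec> n \<oplus> \<one> \<longrightarrow> (\<exists>j. j \<prec> n \<and> el (pair i j) q)) \<and>
    (\<forall>i. i \<prec> n \<oplus> \<one> \<longrightarrow> (\<forall>i'. i' \<prec> n \<oplus> \<one> \<longrightarrow> (\<forall>j. j \<prec> n \<longrightarrow>
       el (pair i j) q \<longrightarrow> el (pair i' j) q \<longrightarrow> i = i')))"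

lemma rec_coded_injection: "fn f \<Longrightarrow> fn g \<Longrightarrow> rec (\<lambda>a. coded_injection (f a) (g a))"
proof (rule rec2)
  show "rec (\<lambda>z. coded_injection (p1 z) (p2 z))"
    unfolding coded_injection_def by (intro rec_intros rec_el)
qed

lemma coded_injection_pred:
  assumes "coded_injection q (n \<oplus> \<one>)"
  shows "\<exists>q'. coded_injection q' n"
proof -
  \<comment> \<open>Send the preimage of \<open>n\<close> to an image of \<open>n + 1\<close> instead.\<close>
  let ?P = "\<lambda>i j. i \<prec> n \<oplus> \<one> \<and> j \<prec> n \<and> (el (pair i j) q \<or> el (pair i n) q \<and> el (pair (n \<oplus> \<one>) j) q)"
  have total: "\<exists>j. j \<prec> n \<oplus> \<one> \<and> el (pair i j) q" if "i \<prec> n \<oplus> \<one> \<oplus> \<one>" for i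
    using that assms by (auto simp: coded_injection_def)
  have inj: "i = i'" if "i \<prec> n \<oplus> \<one> \<oplus> \<one>" "i' \<prec> n \<oplus> \<one> \<oplus> \<one>" "j \<prec> n \<oplus> \<one>" "el (pair i j) q" "el (pair i' j) q"
    for i i' j
    using that assms unfolding coded_injection_def by blast
  have "rec (\<lambda>z. z = pair (p1 z) (p2 z) \<and> ?P (p1 z) (p2 z))"
    by (intro rec_intros rec_el)
  moreover have "z \<prec> pair n n \<oplus> \<one>" if "z = pair (p1 z) (p2 z) \<and> ?P (p1 z) (p2 z)" for z
    using that pair_mono[of "p1 z" n "p2 z" n] by (auto simp: le_def)
  ultimately obtain q' where "\<And>z. el z q' \<longleftrightarrow> z = pair (p1 z) (p2 z) \<and> ?P (p1 z) (p2 z)"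
    using ex_code by blast
  then have q': "el (pair i j) q' \<longleftrightarrow> ?P i j" for i j by simp
  have "\<exists>j. j \<prec> n \<and> el (pair i j) q'" if "i \<prec> n \<oplus> \<one>" for i
  proof -
    have i: "i \<prec> n \<oplus> \<one> \<oplus> \<one>" "i \<noteq> n \<oplus> \<one>" using that by (auto simp: le_def)
    obtain j where j: "j \<prec> n \<oplus> \<one>" "el (pair i j) q" using total i by blast
    obtain k where k: "k \<prec> n \<oplus> \<one>" "el (pair (n \<oplus> \<one>) k) q" using total[of "n \<oplus> \<one>"] by auto
    show ?thesis
    proof (cases "j = n")
      case False
      then show ?thesis using j that q' less_succ by blast
    next
      case True
      \<comment> \<open>Otherwise \<open>i\<close> and \<open>n \<oplus> \<one>\<close> would share
        the image \<open>n\<close>.\<close>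
      then have "k \<noteq> n" using inj[of i "n \<oplus> \<one>" n] i j k by auto
      then show ?thesis using that True j k q' less_succ by blast
    qed
  qed
  moreover have "i = i'" if "i \<prec> n \<oplus> \<one>" "i' \<prec> n \<oplus> \<one>" "j \<prec> n" "el (pair i j) q'" "el (pair i' j) q'" for i i' j
  proof -
    have *: "i \<prec> n \<oplus> \<one> \<oplus> \<one>" "i' \<prec> n \<oplus> \<one> \<oplus> \<one>" "j \<prec> n \<oplus> \<one>" "n \<prec> n \<oplus> \<one>"
      "n \<oplus> \<one> \<prec> n \<oplus> \<one> \<oplus> \<one>" "i \<noteq> n \<oplus> \<one>" "i' \<noteq> n \<oplus> \<one>"
      using that by (auto simp: le_def)
    show ?thesis using that(4,5) inj * unfolding q' by blast
  qed
  ultimately show ?thesis unfolding coded_injection_def by blast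
qed

text \<open>Descent by \<open>coded_injection_pred\<close>, phrased as induction on \<open>k\<close>
  with \<open>m \<oplus> k = n\<close>; a coded injection exists at each \<open>m\<close> down to
  \<zero>, where there is no room for an image. Quantifying over codes keeps the statement
  \<open>\<Sigma>\<^sup>0\<^sub>1\<close>.\<close>

lemma not_coded_injection: "\<not> coded_injection q n"
proof
  assume q: "coded_injection q n"
  have "\<exists>q. n \<prec> n \<or> (\<exists>m. m \<prec> n \<oplus> \<one> \<and> m \<oplus> n = n \<and> coded_injection q m)"
  proof (rule sigma1_induct[where R = "\<lambda>k q. n \<prec> k \<or> (\<exists>m. m \<prec> n \<oplus> \<one> \<and> m \<oplus> k = n \<and> coded_injection q m)"])
    show "rec (\<lambda>z. n \<prec> p1 z \<or> (\<exists>m. m \<prec> n \<oplus> \<one> \<and> m \<oplus> p1 z = n \<and> coded_injection (p2 z) m))"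
      by (intro rec_intros rec_coded_injection)
    show "\<exists>q. n \<prec> \<zero> \<or> (\<exists>m. m \<prec> n \<oplus> \<one> \<and> m \<oplus> \<zero> = n \<and> coded_injection q m)"
      using q by auto
  next
    fix k q assume *: "n \<prec> k \<or> (\<exists>m. m \<prec> n \<oplus> \<one> \<and> m \<oplus> k = n \<and> coded_injection q m)"
    show "\<exists>q. n \<prec> k \<oplus> \<one> \<or> (\<exists>m. m \<prec> n \<oplus> \<one> \<and> m \<oplus> (k \<oplus> \<one>) = n \<and> coded_injection q m)"
    proof (cases "n \<prec> k \<oplus> \<one>")
      case False
      then have "k \<prec> n" by simp
      then obtain m where m: "k \<oplus> (m \<oplus> \<one>) = n" using less_imp_ex by blast
      moreover obtain m' where m': "m' \<oplus> k = n" "coded_injection q m'" using * False by (auto simp: le_def)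
      ultimately have "m' = m \<oplus> \<one>" by (metis M.add_right_cancel M.add.commute)
      then obtain q' where "coded_injection q' m" using coded_injection_pred m' by blast
      moreover have "m \<oplus> (k \<oplus> \<one>) = n" using m by (simp only: M.add.assoc M.add.commute M.add.left_commute)
      moreover have "m \<preceq> n" using m le_add' le_add M.order_trans by metis
      ultimately show ?thesis by auto
    qed auto
  qed
  then obtain q where "coded_injection q \<zero>" by auto
  then have "\<exists>j. j \<prec> \<zero> \<and> el (pair \<zero> j) q" unfolding coded_injection_def by simp
  then show False using not_less_zero by blast
qed

text \<open>The restriction of \<open>H\<close> to the relevant arguments and values is bounded and
  hence has a code.\<close>

lemma pigeonhole:
  assumes "rec (\<lambda>z. H (p1 z) (p2 z))" and total: "\<And>i. i \<preceq> n \<Longrightarrow> \<exists>j. j \<prec> n \<and> H i j"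
    and inj: "\<And>i i' j. i \<preceq> n \<Longrightarrow> i' \<preceq> n \<Longrightarrow> j \<prec> n \<Longrightarrow> H i j \<Longrightarrow> H i' j \<Longrightarrow> i = i'"
  shows False
proof -
  let ?P = "\<lambda>z. z = pair (p1 z) (p2 z) \<and> p1 z \<preceq> n \<and> p2 z \<prec> n \<and> H (p1 z) (p2 z)"
  have "rec ?P" by (intro rec_intros assms(1))
  moreover have "z \<prec> pair n n \<oplus> \<one>" if "?P z" for z
    using that pair_mono[of "p1 z" n "p2 z" n] by (auto simp: le_def)
  ultimately obtain q where q: "\<And>z. el z q \<longleftrightarrow> ?P z" using ex_code by blast
  have "coded_injection q n" unfolding coded_injection_def q using total inj by simp
  then show False using not_coded_injection by blast
qed

section \<open>The least number principle gives a least failing extension\<close>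

text \<open>Elements are smaller than the code, so this is a bounded quantifier.\<close>

lemma rec_ex_el:
  assumes "rec (\<lambda>z. Q (p1 z) (p2 z))" "fn f"
  shows "rec (\<lambda>a. \<exists>x. el x (f a) \<and> Q a x)"
proof -
  have "(\<exists>x. el x (f a) \<and> Q a x) \<longleftrightarrow> (\<exists>x. x \<prec> f a \<and> (el x (f a) \<and> Q a x))" for a
    using el_less by blast
  moreover have "rec (\<lambda>z. el (p2 z) (f (p1 z)))"
    by (intro rec_el rec_intros fn_compose[OF fn_p1 assms(2)])
  then have "rec (\<lambda>a. \<exists>x. x \<prec> f a \<and> (el x (f a) \<and> Q a x))"
    by (intro rec_intros assms)
  ultimately show ?thesis by simp
qed

lemma rec_all_el:
  assumes "rec (\<lambda>z. Q (p1 z) (p2 z))" "fn f"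
  shows "rec (\<lambda>a. \<forall>x. el x (f a) \<longrightarrow> Q a x)"
  using rec_not[OF rec_ex_el[OF rec_not[OF assms(1)] assms(2)]] by simp

text \<open>This is \<open>card_in\<close> with the bijection coded by a number and unique existence
  spelled out with bounded quantifiers, so that it becomes a set of \<open>M\<close>.\<close>

definition bij_code :: "'a \<Rightarrow> 'a \<Rightarrow> 'a \<Rightarrow> bool" where
  "bij_code f X n \<longleftrightarrow>
     (\<forall>z. el z f \<longrightarrow> z = pair (p1 z) (p2 z) \<and> p1 z \<prec> n \<and> el (p2 z) X) \<and>
     (\<forall>i. i \<prec> n \<longrightarrow> (\<exists>x. el x X \<and> el (pair i x) f \<and> (\<forall>y. el y X \<longrightarrow> el (pair i y) f \<longrightarrow> y = x))) \<and>
     (\<forall>x. el x X \<longrightarrow> (\<exists>i. i \<prec> n \<and> el (pair i x) f \<and> (\<forall>j. j \<prec> n \<longrightarrow> el (pair j x) f \<longrightarrow> j = i)))"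

lemma rec_bij_code: "fn f \<Longrightarrow> fn g \<Longrightarrow> fn h \<Longrightarrow> rec (\<lambda>a. bij_code (f a) (g a) (h a))"
proof (rule rec3)
  show "rec (\<lambda>z. bij_code (p1 (p1 z)) (p2 (p1 z)) (p2 z))"
    unfolding bij_code_def by (intro rec_intros rec_el rec_all_el rec_ex_el)
qed

lemma set_of_code: "{x. el x q} \<in> sets_of M"
  using rec_el[OF fn_id fn_const[of q]] by (simp add: rec_def)

lemma finite_in_iff_code: "finite_in M X \<longleftrightarrow> (\<exists>q. X = {x. el x q})"
proof
  assume "finite_in M X"
  then obtain b where "X \<in> sets_of M" "\<And>x. x \<in> X \<Longrightarrow> x \<prec> b" by (auto simp: finite_in_def)
  then obtain q where "\<forall>x. el x q \<longleftrightarrow> x \<in> X" using ex_code[OF rec_mem] by blast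
  then show "\<exists>q. X = {x. el x q}" by blast
next
  assume "\<exists>q. X = {x. el x q}"
  then show "finite_in M X" unfolding finite_in_def using set_of_code el_less by blast
qed

text \<open>A bijection between bounded sets is itself bounded, so \<open>ex_code\<close> replaces
  the set quantifier by a number quantifier.\<close>

lemma card_in_iff_code: "card_in M {x. el x q} n \<longleftrightarrow> (\<exists>f. bij_code f q n)"
proof
  assume "card_in M {x. el x q} n"
  then obtain F where F: "F \<in> sets_of M" "\<And>z. z \<in> F \<Longrightarrow> \<exists>i x. z = pair i x \<and> i \<prec> n \<and> el x q"
    "\<And>i. i \<prec> n \<Longrightarrow> \<exists>!x. pair i x \<in> F" "\<And>x. el x q \<Longrightarrow> \<exists>!i. pair i x \<in> F"
    unfolding card_in_def by auto
  have "z \<prec> pair n q \<oplus> \<one>" if "z \<in> F" for z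
    using F(2)[OF that] el_less pair_mono[OF M.less_imp_le M.less_imp_le] by auto
  then obtain f where f: "\<And>z. el z f \<longleftrightarrow> z \<in> F" using ex_code[OF rec_mem] F(1) by blast
  have "bij_code f q n"
    unfolding bij_code_def f
  proof (intro conjI allI impI)
    fix z assume "z \<in> F"
    then show "z = pair (p1 z) (p2 z)" "p1 z \<prec> n" "el (p2 z) q" using F(2) by force+
  next
    fix i assume "i \<prec> n"
    then show "\<exists>x. el x q \<and> pair i x \<in> F \<and> (\<forall>y. el y q \<longrightarrow> pair i y \<in> F \<longrightarrow> y = x)"
      using F(2,3) by (metis pair_inject)
  next
    fix x assume "el x q"
    then show "\<exists>i. i \<prec> n \<and> pair i x \<in> F \<and> (\<forall>j. j \<prec> n \<longrightarrow> pair j x \<in> F \<longrightarrow> j = i)"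
      using F(2,4) by (metis pair_inject)
  qed
  then show "\<exists>f. bij_code f q n" ..
next
  assume "\<exists>f. bij_code f q n"
  then obtain f where f: "bij_code f q n" ..
  note b = f[unfolded bij_code_def]
  have mem: "i \<prec> n \<and> el x q" if "el (pair i x) f" for i x using b that by force
  show "card_in M {x. el x q} n"
    unfolding card_in_def
  proof (intro bexI[of _ "{z. el z f}"] conjI set_of_code allI ballI impI)
    fix z assume "z \<in> {z. el z f}"
    then have "z = pair (p1 z) (p2 z) \<and> p1 z \<prec> n \<and> el (p2 z) q" using b by blast
    then show "\<exists>i x. z = pair i x \<and> i \<prec> n \<and> x \<in> {x. el x q}" by blast
  next
    fix i assume "i \<prec> n"
    then obtain x where "el (pair i x) f" "\<forall>y. el y q \<longrightarrow> el (pair i y) f \<longrightarrow> y = x" using b by blast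
    then show "\<exists>!x. pair i x \<in> {z. el z f}" using mem by (intro ex1I[of _ x]) blast+
  next
    fix x assume "x \<in> {x. el x q}"
    then have "el x q" by simp
    then obtain i where "el (pair i x) f" "\<forall>j. j \<prec> n \<longrightarrow> el (pair j x) f \<longrightarrow> j = i" using b by blast
    then show "\<exists>!i. pair i x \<in> {z. el z f}" using mem by (intro ex1I[of _ i]) blast+
  qed
qed

text \<open>The matrix of a \<open>\<Sigma>\<^sup>0\<^sub>2\<close> formula: the numbers from
  \<open>X0\<close> to \<open>l\<close> will be quantified existentially, and \<open>v\<close>, a
  candidate for the extending vertex, universally.\<close>

definition failing_code :: "'a set \<Rightarrow> 'a set \<Rightarrow> 'a \<Rightarrow> 'a \<Rightarrow> 'a \<Rightarrow> 'a \<Rightarrow> 'a \<Rightarrow> 'a \<Rightarrow> 'a \<Rightarrow> 'a \<Rightarrow> bool" where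
  "failing_code V E X0 X1 f0 f1 k l n v \<longleftrightarrow>
     (\<forall>x. el x X0 \<longrightarrow> x \<in> V \<and> \<not> el x X1) \<and> (\<forall>x. el x X1 \<longrightarrow> x \<in> V) \<and>
     bij_code f0 X0 k \<and> bij_code f1 X1 l \<and> k \<oplus> l = n \<and>
     \<not> (v \<in> V \<and> \<not> el v X0 \<and> \<not> el v X1 \<and> (\<forall>x. el x X0 \<longrightarrow> pair v x \<in> E) \<and> (\<forall>x. el x X1 \<longrightarrow> pair v x \<notin> E))"

lemma some_extension_fails_iff_code:
  "some_extension_fails_in M V E n \<longleftrightarrow> (\<exists>X0 X1 f0 f1 k l. \<forall>v. failing_code V E X0 X1 f0 f1 k l n v)"
proof -
  have finite: "finite_in M {x. el x q}" for q by (auto simp: finite_in_iff_code)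
  have pair: "extension_pair_in M V n {x. el x X0} {x. el x X1} \<longleftrightarrow>
     (\<forall>x. el x X0 \<longrightarrow> x \<in> V \<and> \<not> el x X1) \<and> (\<forall>x. el x X1 \<longrightarrow> x \<in> V) \<and>
     (\<exists>f0 f1 k l. bij_code f0 X0 k \<and> bij_code f1 X1 l \<and> k \<oplus> l = n)" for X0 X1
    by (auto simp: extension_pair_in_def finite card_in_iff_code)
  have extp: "extension_property_in M V E {x. el x X0} {x. el x X1} \<longleftrightarrow> (\<exists>v. v \<in> V \<and> \<not> el v X0 \<and> \<not> el v X1 \<and>
     (\<forall>x. el x X0 \<longrightarrow> pair v x \<in> E) \<and> (\<forall>x. el x X1 \<longrightarrow> pair v x \<notin> E))" for X0 X1
    unfolding extension_property_in_def by auto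
  have "some_extension_fails_in M V E n \<longleftrightarrow>
    (\<exists>X0 X1. extension_pair_in M V n {x. el x X0} {x. el x X1} \<and> \<not> extension_property_in M V E {x. el x X0} {x. el x X1})"
  proof
    assume "some_extension_fails_in M V E n"
    then obtain X0 X1 where X: "extension_pair_in M V n X0 X1" "\<not> extension_property_in M V E X0 X1"
      unfolding some_extension_fails_in_def by blast
    moreover from X(1) obtain q0 q1 where "X0 = {x. el x q0}" "X1 = {x. el x q1}"
      unfolding extension_pair_in_def finite_in_iff_code by blast
    ultimately show "\<exists>X0 X1. extension_pair_in M V n {x. el x X0} {x. el x X1} \<and>
      \<not> extension_property_in M V E {x. el x X0} {x. el x X1}" by blast
  next
    assume "\<exists>X0 X1. extension_pair_in M V n {x. el x X0} {x. el x X1} \<and>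
      \<not> extension_property_in M V E {x. el x X0} {x. el x X1}"
    then show "some_extension_fails_in M V E n"
      unfolding some_extension_fails_in_def using set_of_code by blast
  qed
  also have "\<dots> \<longleftrightarrow> (\<exists>X0 X1 f0 f1 k l. \<forall>v. failing_code V E X0 X1 f0 f1 k l n v)"
    unfolding pair extp failing_code_def by (simp only: all_simps(1,2) all_conj_distrib) blast
  finally show ?thesis .
qed

text \<open>A relation that is a set of \<open>M\<close> enters the scheme as the set parameter of
  one fixed formula.\<close>

lemma L_Sigma2_least:
  assumes "models_L_Sigma2 M" and rec: "rec (\<lambda>z. R (p1 (p1 z)) (p2 (p1 z)) (p2 z))"
    and "\<exists>a b. \<forall>c. R a b c"
  shows "\<exists>a. (\<exists>b. \<forall>c. R a b c) \<and> (\<forall>a'. a' \<prec> a \<longrightarrow> \<not> (\<exists>b. \<forall>c. R a' b c))"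
proof -
  define \<phi> where "\<phi> = Exists 1 (Forall 2 (Mem (pair_term (pair_term (NVar 0) (NVar 1)) (NVar 2)) 0))"
  define A where "A = {z. R (p1 (p1 z)) (p2 (p1 z)) (p2 z)}"
  have "sigma2 \<phi>" by (auto simp: sigma2_def pi1_def \<phi>_def)
  moreover have "set_assignment M (\<lambda>_. A)" using rec by (simp add: set_assignment_def rec_def A_def)
  moreover have sat: "sat M (e(0 := a)) (\<lambda>_. A) \<phi> \<longleftrightarrow> (\<exists>b. \<forall>c. R a b c)" for e a
    by (simp add: \<phi>_def A_def)
  ultimately show ?thesis
    using assms(1)[unfolded models_L_Sigma2_def, rule_format, of \<phi> "\<lambda>_. A" "\<lambda>_. \<zero>" 0] assms(3)
    by (simp only: sat)
qed

lemma L_Sigma2_imp_least_failing: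
  assumes "models_L_Sigma2 M"
  shows "models_least_failing_extension M"
  unfolding models_least_failing_extension_def
proof (intro ballI impI)
  fix V E assume V: "V \<in> sets_of M" and E: "E \<in> sets_of M" and "graph_in M V E" "\<not> random_graph_in M V E"
  then obtain n where n: "some_extension_fails_in M V E n"
    unfolding random_graph_in_def some_extension_fails_in_def by blast
  \<comment> \<open>The scheme offers a single existential number quantifier, so the six codes are
    packed into \<open>q\<close>.\<close>
  define R where "R n q v = failing_code V E (p1 (p1 q)) (p2 (p1 q)) (p1 (p1 (p2 q))) (p2 (p1 (p2 q)))
    (p1 (p2 (p2 q))) (p2 (p2 (p2 q))) n v" for n q v
  have R: "some_extension_fails_in M V E n \<longleftrightarrow> (\<exists>q. \<forall>v. R n q v)" for n
    unfolding some_extension_fails_iff_code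
  proof
    assume "\<exists>X0 X1 f0 f1 k l. \<forall>v. failing_code V E X0 X1 f0 f1 k l n v"
    then obtain X0 X1 f0 f1 k l where "\<forall>v. failing_code V E X0 X1 f0 f1 k l n v" by blast
    then have "\<forall>v. R n (pair (pair X0 X1) (pair (pair f0 f1) (pair k l))) v" by (simp add: R_def)
    then show "\<exists>q. \<forall>v. R n q v" ..
  next
    assume "\<exists>q. \<forall>v. R n q v"
    then show "\<exists>X0 X1 f0 f1 k l. \<forall>v. failing_code V E X0 X1 f0 f1 k l n v" unfolding R_def by blast
  qed
  have "rec (\<lambda>z. R (p1 (p1 z)) (p2 (p1 z)) (p2 z))"
    unfolding R_def failing_code_def
    by (intro rec_intros rec_el rec_all_el rec_bij_code V E)
  from L_Sigma2_least[OF assms this] n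
  show "\<exists>n. some_extension_fails_in M V E n \<and> (\<forall>m. m \<prec> n \<longrightarrow> \<not> some_extension_fails_in M V E m)"
    unfolding R by blast
qed

section \<open>A graph for a given property\<close>

text \<open>Comprehension has one number variable, so the triple is held in a fresh variable
  \<open>w\<close> and decoded by bounded quantifiers. The fresh variable \<open>u\<close> supplies
  the unbounded quantifier of both forms.\<close>

lemma rec_matrix:
  assumes "delta0 \<theta>" "set_assignment M S"
  shows "rec (\<lambda>t. sat M (e(x := p1 (p1 t), y := p2 (p1 t), z := p2 t)) S \<theta>)"
proof -
  obtain N where N: "\<And>w e a. w \<ge> N \<Longrightarrow> sat M (e(w := a)) S \<theta> = sat M e S \<theta>"
    using ex_fresh_variable[of M S \<theta>] by auto
  define w where "w = N + x + y + z + 1"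
  define p where "p = w + 1"
  define q where "q = w + 2"
  define u where "u = w + 3"
  note defs = u_def q_def p_def w_def
  \<comment> \<open>The copies \<open>p\<close> and \<open>q\<close> are needed because \<open>x\<close>, \<open>y\<close>, \<open>z\<close> may coincide.\<close>
  define \<Theta> where "\<Theta> = bex x (NVar w) (bex p (NVar w) (Conj (Equal (NVar p) (NVar x))
    (bex y (NVar w) (bex q (NVar w) (Conj (Equal (NVar q) (NVar y))
      (bex z (NVar w) (Conj (Equal (NVar w) (pair_term (pair_term (NVar p) (NVar q)) (NVar z))) \<theta>)))))))"
  have neq: "x \<noteq> w" "y \<noteq> w" "z \<noteq> w" "x \<noteq> p" "y \<noteq> p" "z \<noteq> p" "x \<noteq> q" "y \<noteq> q" "z \<noteq> q"
    "x \<noteq> u" "y \<noteq> u" "z \<noteq> u" "p \<noteq> w" "q \<noteq> w" "u \<noteq> w" "p \<noteq> q" "p \<noteq> u" "q \<noteq> u"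
    by (simp_all add: defs)
  have \<theta>: "sat M (e(w := t, u := d, x := a, p := a', y := b, q := b', z := c)) S \<theta> \<longleftrightarrow>
      sat M (e(x := a, y := b, z := c)) S \<theta>" for t d a a' b b' c
  proof -
    have "e(w := t, u := d, x := a, p := a', y := b, q := b', z := c) =
        e(x := a, y := b, z := c, w := t, u := d, p := a', q := b')"
      using neq by (auto simp: fun_eq_iff)
    then show ?thesis using N by (simp add: defs)
  qed
  have sat: "sat M (e(w := t, u := d)) S \<Theta> \<longleftrightarrow> (\<exists>a b c. t = pair (pair a b) c \<and> sat M (e(x := a, y := b, z := c)) S \<theta>)" for t d
    unfolding \<Theta>_def using neq neq[symmetric]
      M.order_trans[OF fst_le_pair fst_le_pair] M.order_trans[OF snd_le_pair fst_le_pair]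
    by (simp add: \<theta>) (auto simp: snd_le_pair)
  have "delta0 \<Theta>" using neq neq[symmetric] assms(1) by (simp add: \<Theta>_def)
  then have "\<exists>A\<in>sets_of M. \<forall>t. t \<in> A \<longleftrightarrow> sat M (e(w := t)) S (Exists u \<Theta>)"
    using delta1_comprehension[unfolded delta1_comprehension_def, rule_format, of "Exists u \<Theta>" "Forall u \<Theta>" S e w]
      assms(2) by (auto simp: sigma1_def pi1_def sat)
  then obtain A where "A \<in> sets_of M"
    and A: "\<And>a b c. pair (pair a b) c \<in> A \<longleftrightarrow> sat M (e(x := a, y := b, z := c)) S \<theta>"
    by (auto simp: sat)
  \<comment> \<open>\<open>A\<close> contains only genuine triples; pairing the projections again
    gives the right value at all other numbers too.\<close>
  from this(1) have "rec (\<lambda>t. pair (pair (p1 (p1 t)) (p2 (p1 t))) (p2 t) \<in> A)"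
    by (intro rec_intros)
  then show ?thesis by (simp add: A)
qed

text \<open>By \<open>rec_matrix\<close>, every instance of the scheme is about a relation that is a
  set of \<open>M\<close>.\<close>

lemma L_Sigma2I:
  assumes "\<And>R. rec (\<lambda>z. R (p1 (p1 z)) (p2 (p1 z)) (p2 z)) \<Longrightarrow> \<exists>a b. \<forall>c. R a b c \<Longrightarrow>
    \<exists>a. (\<exists>b. \<forall>c. R a b c) \<and> (\<forall>a'. a' \<prec> a \<longrightarrow> \<not> (\<exists>b. \<forall>c. R a' b c))"
  shows "models_L_Sigma2 M"
  unfolding models_L_Sigma2_def
proof (intro allI impI)
  fix \<phi> x e S
  assume "sigma2 \<phi>" "set_assignment M S" and ex: "\<exists>a. sat M (e(x := a)) S \<phi>"
  then obtain y z \<theta> where \<phi>: "\<phi> = Exists y (Forall z \<theta>)" and "delta0 \<theta>"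
    by (auto simp: sigma2_def pi1_def)
  with rec_matrix \<open>set_assignment M S\<close>
  have "rec (\<lambda>t. sat M (e(x := p1 (p1 t), y := p2 (p1 t), z := p2 t)) S \<theta>)" by blast
  from assms[of "\<lambda>a b c. sat M (e(x := a, y := b, z := c)) S \<theta>", OF this] ex
  show "\<exists>a. sat M (e(x := a)) S \<phi> \<and> (\<forall>b. b \<prec> a \<longrightarrow> \<not> sat M (e(x := b)) S \<phi>)"
    unfolding \<phi> sat.simps by blast
qed

section \<open>The graph of a relation \<open>R\<close> and its failing extensions\<close>

context
  fixes R :: "'a \<Rightarrow> 'a \<Rightarrow> 'a \<Rightarrow> bool"
  assumes rec_R: "rec (\<lambda>z. R (p1 (p1 z)) (p2 (p1 z)) (p2 z))"
begin

text \<open>The vertex \<open>v = ((f, n), s)\<close> represents the enumeration \<open>f\<close> of length \<open>n\<close> at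
  stage \<open>s\<close>; \<open>nb\<close> orients the edges from the larger to the smaller endpoint.\<close>

definition active :: "'a \<Rightarrow> bool" where
  "active v \<longleftrightarrow>
     (\<forall>i. i \<prec> p1 (p1 v) \<longrightarrow> (\<forall>x. x \<prec> p1 (p1 v) \<longrightarrow> (\<forall>y. y \<prec> p1 (p1 v) \<longrightarrow>
        el (pair i x) (p1 (p1 v)) \<longrightarrow> el (pair i y) (p1 (p1 v)) \<longrightarrow> x = y))) \<and>
     (\<forall>m. m \<prec> p2 (p1 v) \<longrightarrow> (\<forall>y. y \<prec> p1 (p1 v) \<longrightarrow> (\<exists>z. z \<prec> p2 v \<and> \<not> R m y z)))"

definition nb :: "'a \<Rightarrow> 'a \<Rightarrow> bool" where
  "nb v x \<longleftrightarrow> active v \<and> (\<exists>i. i \<prec> p2 (p1 v) \<and> el (pair i x) (p1 (p1 v)))"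

definition edges :: "'a set" where
  "edges = {z. z = pair (p1 z) (p2 z) \<and> (nb (p1 z) (p2 z) \<or> nb (p2 z) (p1 z))}"

lemma rec_nb: "fn f \<Longrightarrow> fn g \<Longrightarrow> rec (\<lambda>a. nb (f a) (g a))"
proof (rule rec2)
  show "rec (\<lambda>z. nb (p1 z) (p2 z))"
    unfolding nb_def active_def by (intro rec_intros rec_el rec3[OF rec_R])
qed

lemma pair_in_edges: "pair u v \<in> edges \<longleftrightarrow> nb u v \<or> nb v u"
  by (simp add: edges_def)

text \<open>The number \<open>x\<close> occurs in the enumeration that is a component of
  \<open>v\<close>. This excludes loops and controls the edges oriented towards a large
  vertex.\<close>

lemma nb_less: "nb v x \<Longrightarrow> x \<prec> v"
proof -
  assume "nb v x"
  then obtain i where "el (pair i x) (p1 (p1 v))" by (auto simp: nb_def)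
  then show ?thesis
    using el_less snd_le_pair p1_le by (meson M.le_less_trans M.less_le_trans M.order_trans)
qed

lemma edges_in_sets: "edges \<in> sets_of M"
proof -
  have "rec (\<lambda>z. z = pair (p1 z) (p2 z) \<and> (nb (p1 z) (p2 z) \<or> nb (p2 z) (p1 z)))"
    by (intro rec_intros rec_nb)
  then show ?thesis by (simp add: rec_def edges_def)
qed

lemma UNIV_in_sets: "UNIV \<in> sets_of M" and empty_in_sets: "{} \<in> sets_of M"
  using rec_const[of True] rec_const[of False] by (simp_all add: rec_def)

lemma graph_edges: "graph_in M UNIV edges"
  unfolding graph_in_def
proof (intro conjI)
  show "\<forall>u\<in>UNIV. pair u u \<notin> edges" using nb_less M.less_irrefl by (auto simp: pair_in_edges)
  show "\<forall>z\<in>edges. \<exists>u\<in>UNIV. \<exists>v\<in>UNIV. z = pair u v" by (auto simp: edges_def)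
qed (auto simp: UNIV_in_sets edges_in_sets pair_in_edges)

text \<open>The vertex for a pair enumerates \<open>X0\<close> at a stage by which all required
  failures are witnessed, so its smaller neighbours are exactly the elements of
  \<open>X0\<close>.\<close>

lemma extension_property_edges:
  assumes "\<And>m. m \<prec> n \<Longrightarrow> \<not> (\<exists>b. \<forall>c. R m b c)"
  shows "\<not> some_extension_fails_in M UNIV edges n"
proof
  assume "some_extension_fails_in M UNIV edges n"
  then obtain X0 X1 f0 f1 k l where fail: "\<And>v. failing_code UNIV edges X0 X1 f0 f1 k l n v"
    unfolding some_extension_fails_iff_code by blast
  then have bij: "bij_code f0 X0 k" and disj: "\<And>x. el x X0 \<Longrightarrow> \<not> el x X1" and "k \<oplus> l = n"
    unfolding failing_code_def by blast+
  have "k \<preceq> n" using \<open>k \<oplus> l = n\<close> le_add by blast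
  \<comment> \<open>Bounding is applied to one number \<open>t\<close> coding both \<open>m\<close>
    and \<open>y\<close>; the guard is there because some \<open>t\<close> below
    \<open>pair k f0\<close> may have a first component for which no failure is known.\<close>
  have "rec (\<lambda>z. p1 (p1 z) \<prec> k \<longrightarrow> \<not> R (p1 (p1 z)) (p2 (p1 z)) (p2 z))"
    by (intro rec_intros rec_R)
  moreover have "\<exists>c. p1 t \<prec> k \<longrightarrow> \<not> R (p1 t) (p2 t) c" for t
    using assms \<open>k \<preceq> n\<close> M.less_le_trans by blast
  ultimately obtain s where s: "\<And>t. t \<prec> pair k f0 \<Longrightarrow> \<exists>c. c \<prec> s \<and> (p1 t \<prec> k \<longrightarrow> \<not> R (p1 t) (p2 t) c)"
    using collection[where R = "\<lambda>t c. p1 t \<prec> k \<longrightarrow> \<not> R (p1 t) (p2 t) c" and k = "pair k f0"] by blast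
  \<comment> \<open>Adding \<open>X0\<close> and \<open>X1\<close> to the stage places
    \<open>v\<close> above all their elements, so no edge can be oriented from such an element to
    \<open>v\<close>.\<close>
  define v where "v = pair (pair f0 k) (s \<oplus> X0 \<oplus> X1)"
  have less_v: "x \<prec> v" if "el x X0 \<or> el x X1" for x
  proof -
    have "X0 \<preceq> s \<oplus> X0 \<oplus> X1" "X1 \<preceq> s \<oplus> X0 \<oplus> X1"
      using le_add' le_add M.order_trans by blast+
    then have "X0 \<preceq> v" "X1 \<preceq> v" unfolding v_def using snd_le_pair M.order_trans by blast+
    then show ?thesis using that el_less M.less_le_trans by blast
  qed
  have f0: "i \<prec> k \<and> el x X0" if "el (pair i x) f0" for i x
    using bij that unfolding bij_code_def by force
  have "active v"
    unfolding active_def v_def p1_pair p2_pair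
  proof (intro conjI allI impI)
    fix i x y assume *: "el (pair i x) f0" "el (pair i y) f0"
    then have "i \<prec> k" "el x X0" "el y X0" using f0 by auto
    then show "x = y" using bij * unfolding bij_code_def by blast
  next
    fix m y assume my: "m \<prec> k" "y \<prec> f0"
    then have "pair m y \<prec> pair k f0" by (intro pair_less M.add_strict_mono)
    then obtain c where "c \<prec> s" "\<not> R m y c" using s[of "pair m y"] my by auto
    moreover have "s \<preceq> s \<oplus> X0 \<oplus> X1" using le_add by (simp add: M.add.assoc)
    ultimately show "\<exists>z. z \<prec> s \<oplus> X0 \<oplus> X1 \<and> \<not> R m y z" using M.less_le_trans by blast
  qed
  have nb: "nb v x \<longleftrightarrow> el x X0" for x
  proof
    show "nb v x \<Longrightarrow> el x X0" unfolding nb_def v_def p1_pair p2_pair using f0 by blast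
    assume "el x X0"
    then obtain i where "i \<prec> k" "el (pair i x) f0" using bij unfolding bij_code_def by blast
    then show "nb v x" using \<open>active v\<close> unfolding nb_def v_def p1_pair p2_pair by blast
  qed
  have "\<not> el v X0" "\<not> el v X1" using less_v M.less_irrefl by blast+
  moreover have "pair v x \<in> edges" if "el x X0" for x using that nb by (simp add: pair_in_edges)
  moreover have "pair v x \<notin> edges" if "el x X1" for x
  proof -
    have "\<not> nb x v" using less_v[of x] that nb_less M.less_asym by blast
    then show ?thesis using nb disj that by (auto simp: pair_in_edges)
  qed
  ultimately show False using fail[of v] unfolding failing_code_def by blast
qed

lemma extension_fails_edges:
  assumes y: "\<And>c. R m y c"
  shows "some_extension_fails_in M UNIV edges (m \<oplus> \<one>)"
proof -
  \<comment> \<open>Enumeration code above \<open>y\<close>, length \<one>, stage \<zero>: such a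
    vertex is never active, because \<open>active\<close> would require a witness below \<zero>. The
    summand \<open>i\<close> makes the vertices distinct.\<close>
  define g where "g i = pair (pair (y \<oplus> \<one> \<oplus> i) \<one>) \<zero>" for i
  define A where "A = {x. \<exists>i. i \<prec> m \<oplus> \<one> \<and> x = g i}"
  have g_inj: "g i = g j \<longleftrightarrow> i = j" for i j by (simp add: g_def)
  have not_nb: "\<not> nb (g i) v" for i v
  proof
    assume "nb (g i) v"
    then have "\<forall>m. m \<prec> \<one> \<longrightarrow> (\<forall>x. x \<prec> y \<oplus> \<one> \<oplus> i \<longrightarrow> (\<exists>z. z \<prec> \<zero> \<and> \<not> R m x z))"
      unfolding nb_def active_def g_def by simp
    moreover have "\<zero> \<prec> y \<oplus> \<one> \<oplus> i" by (simp add: M.add_pos_nonneg M.add_nonneg_pos zero_less_one)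
    ultimately show False using zero_less_one not_less_zero by blast
  qed
  have "rec (\<lambda>x. \<exists>i. i \<prec> m \<oplus> \<one> \<and> x = g i)" unfolding g_def by (intro rec_intros)
  then have A_sets: "A \<in> sets_of M" by (simp add: rec_def A_def)
  have "g i \<prec> g m \<oplus> \<one>" if "i \<prec> m \<oplus> \<one>" for i
    using that unfolding g_def less_succ_iff_le by (intro pair_mono M.add_mono) simp_all
  then have finite_A: "finite_in M A" using A_sets unfolding finite_in_def A_def by blast
  have "rec (\<lambda>z. \<exists>i. i \<prec> m \<oplus> \<one> \<and> z = pair i (g i))" unfolding g_def by (intro rec_intros)
  then have "{z. \<exists>i. i \<prec> m \<oplus> \<one> \<and> z = pair i (g i)} \<in> sets_of M" by (simp add: rec_def)
  then have card_A: "card_in M A (m \<oplus> \<one>)"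
    unfolding card_in_def by (rule bexI[rotated]) (auto simp: A_def g_inj)
  have card_empty: "card_in M {} \<zero>"
    unfolding card_in_def using empty_in_sets not_less_zero by (intro bexI[of _ "{}"]) auto
  have "finite_in M {}" using empty_in_sets by (simp add: finite_in_def)
  then have pair: "extension_pair_in M UNIV (m \<oplus> \<one>) A {}"
    unfolding extension_pair_in_def using finite_A card_A card_empty M.add_0_right by blast
  have "\<not> extension_property_in M UNIV edges A {}"
  proof
    assume "extension_property_in M UNIV edges A {}"
    then obtain v where "\<And>x. x \<in> A \<Longrightarrow> pair v x \<in> edges" unfolding extension_property_in_def by blast
    \<comment> \<open>The vertices \<open>g i\<close> have no smaller neighbours, so every edge to
      them is oriented away from \<open>v\<close>.\<close>
    then have nb: "nb v (g i)" if "i \<preceq> m" for i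
      using that not_nb by (auto simp: A_def pair_in_edges)
    define f where "f = p1 (p1 v)"
    define n where "n = p2 (p1 v)"
    have active: "active v" using nb[of \<zero>] by (simp add: nb_def)
    have ex: "\<exists>j. j \<prec> n \<and> el (pair j (g i)) f" if "i \<preceq> m" for i
      using nb[OF that] by (simp add: nb_def n_def f_def)
    have unique: "x = x'" if "el (pair j x) f" "el (pair j x') f" for j x x'
    proof -
      have "j \<prec> f" "x \<prec> f" "x' \<prec> f"
        using that el_less fst_le_pair snd_le_pair M.le_less_trans by blast+
      then show ?thesis using active that unfolding active_def f_def by blast
    qed
    have "m \<prec> n"
    proof (rule ccontr)
      assume "\<not> m \<prec> n"
      then have "n \<preceq> m" by simp
      \<comment> \<open>If \<open>n \<preceq> m\<close>, the vertices \<open>g i\<close> with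
        \<open>i \<preceq> n\<close> all occupy positions below \<open>n\<close>; an active
        \<open>v\<close> has a single-valued enumeration, so no two share a position.\<close>
      have "rec (\<lambda>z. el (pair (p2 z) (g (p1 z))) f)" unfolding g_def by (intro rec_intros rec_el)
      then show False
      proof (rule pigeonhole[where n = n])
        show "\<exists>j. j \<prec> n \<and> el (pair j (g i)) f" if "i \<preceq> n" for i
          using ex that \<open>n \<preceq> m\<close> M.order_trans by blast
        show "i = i'" if "el (pair j (g i)) f" "el (pair j (g i')) f" for i i' j
          using unique[OF that] g_inj by blast
      qed
    qed
    \<comment> \<open>Being listed in \<open>f\<close>, the vertex \<open>g \<zero>\<close> lies
      between \<open>y\<close> and \<open>f\<close>. Activity of \<open>v\<close> then demands a
      \<open>z\<close> with \<open>\<not> R m y z\<close>, against the assumption on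
      \<open>y\<close>.\<close>
    obtain j where "el (pair j (g \<zero>)) f" using ex[of \<zero>] by auto
    then have "g \<zero> \<prec> f" using el_less snd_le_pair M.le_less_trans by blast
    moreover have "y \<oplus> \<one> \<oplus> \<zero> \<preceq> g \<zero>"
      unfolding g_def using M.order_trans[OF fst_le_pair fst_le_pair] .
    then have "y \<prec> g \<zero>" by (simp add: succ_le_iff)
    ultimately have "y \<prec> f" by order
    then show False using active \<open>m \<prec> n\<close> y unfolding active_def f_def n_def by blast
  qed
  then show ?thesis
    unfolding some_extension_fails_in_def using pair A_sets empty_in_sets by blast
qed

text \<open>For the least failing \<open>n\<close> there is an \<open>m \<prec> n\<close> with the
  property, while every \<open>a\<close> with the property satisfies
  \<open>n \<preceq> a \<oplus> \<one>\<close>; so \<open>m\<close> is least.\<close>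

lemma least_failing_imp_least:
  assumes "models_least_failing_extension M" and "\<exists>a b. \<forall>c. R a b c"
  shows "\<exists>a. (\<exists>b. \<forall>c. R a b c) \<and> (\<forall>a'. a' \<prec> a \<longrightarrow> \<not> (\<exists>b. \<forall>c. R a' b c))"
proof -
  obtain a where "some_extension_fails_in M UNIV edges (a \<oplus> \<one>)"
    using assms(2) extension_fails_edges by blast
  then have "\<not> random_graph_in M UNIV edges"
    unfolding random_graph_in_def some_extension_fails_in_def by blast
  then obtain n where n: "some_extension_fails_in M UNIV edges n"
    "\<And>m. m \<prec> n \<Longrightarrow> \<not> some_extension_fails_in M UNIV edges m"
    using assms(1) graph_edges UNIV_in_sets edges_in_sets unfolding models_least_failing_extension_def by blast
  then obtain m where m: "m \<prec> n" "\<exists>b. \<forall>c. R m b c"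
    using extension_property_edges by blast
  have "n \<preceq> a \<oplus> \<one>" if "\<exists>b. \<forall>c. R a b c" for a
    using that n(2) extension_fails_edges by (metis M.not_less)
  then have "\<not> a \<prec> m" if "\<exists>b. \<forall>c. R a b c" for a
    using that m(1) succ_le_iff M.less_le_trans M.not_less by metis
  then show ?thesis using m(2) by blast
qed

end

lemma least_failing_imp_L_Sigma2:
  assumes "models_least_failing_extension M"
  shows "models_L_Sigma2 M"
  using least_failing_imp_least[OF _ assms] by (rule L_Sigma2I)

end

theorem theorem5p1:
  fixes M :: "'a l2_structure"
  assumes "models_RCA0 M"
  shows "models_least_failing_extension M \<longleftrightarrow> models_L_Sigma2 M"
proof -
  interpret rca M using assms by unfold_locales
  show ?thesis using least_failing_imp_L_Sigma2 L_Sigma2_imp_least_failing by blast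
qed

end
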